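(* Let $(A,N)$ be a Nijenhuis algebra and $X$ a set. Let $(M(X),P_X)$, $j_X:X\to M(X)$, the left operated submodule $I_X\subseteq M(X)$ and the induced operator $\overline{P}_X$ on $M(X)/I_X$ be as defined in the context, and let $\pi: M(X)\to M(X)/I_X$ be the quotient map. Then $(M(X)/I_X,\overline{P}_X)$ together with the map $j:=\pi\circ j_X: X\to M(X)\to M(X)/I_X$ is the free left $(A,N)$-module generated by $X$.
   Context: Throughout, $\mathbf{k}$ is a commutative ring with unit; all modules, algebras, tensor products and linear maps are over $\mathbf{k}$; algebras are associative with unit ($1_A$ denotes the unit of $A$) and modules are unital. A Nijenhuis algebra $(A,N)$ is an algebra $A$ with a linear map $N:A\to A$ such that $N(a)N(b)=N\big(N(a)b+aN(b)-N(ab)\big)$ for all $a,b\in A$. A left $(A,N)$-module $(M,N_M)$ is a left $A$-module $M$ with a linear map $N_M:M\to M$ such that $N(a)N_M(m)=N_M\big(N(a)m+aN_M(m)-N_M(am)\big)$ for all $a\in A$, $m\in M$. A left $(A,N)$-module homomorphism $(M,N_M)\to(M',N_{M'})$ is a left $A$-module homomorphism $f:M\to M'$ with $f\circ N_M=N_{M'}\circ f$. A free left $(A,N)$-module generated by a set $X$ is a left $(A,N)$-module $(F(X),N_{F(X)})$ together with a set map $j:X\to F(X)$ such that for any left $(A,N)$-module $(M,N_M)$ and any set map $f:X\to M$ there is a unique left $(A,N)$-module homomorphism $\widetilde f:F(X)\to M$ with $\widetilde f\circ j=f$. A left operated $A$-module is a pair $(M,P_M)$ of a left $A$-module $M$ and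 a linear map $P_M:M\to M$; a left operated submodule is an $A$-submodule stable under $P_M$. Construction: $M(X):=\bigoplus_{n\geq 1}A^{\otimes n}X$, where $A^{\otimes n}X=A^{\otimes n}\otimes \mathbf{k}X$ and $\mathbf{k}X$ is the free $\mathbf{k}$-module on $X$. $A$ acts on the left by multiplication on the leftmost tensor factor. $P_X:M(X)\to M(X)$ is the additive map with $P_X\big((a_1\otimes\cdots\otimes a_n)x\big)=(1_A\otimes a_1\otimes\cdots\otimes a_n)x$ for $a_1,\dots,a_n\in A$, $x\in X$. The map $j_X:X\to M(X)$ is $x\mapsto 1_A\otimes x\in AX$. $I_X$ is the left operated submodule of $M(X)$ generated by $\{N(a)P_X(m)-P_X(N(a)m+aP_X(m)-P_X(am)) \mid a\in A,\ m\in M(X)\}$, and $\overline{P}_X(m+I_X):=P_X(m)+I_X$. *)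

theory Defs
  imports "HOL-Algebra.Module" "HOL-Algebra.AbelCoset"
begin

section \<open>Linear maps, submodules and quotients\<close>

definition linear_maps :: "'k ring \<Rightarrow> ('k, 'm, 'y) module_scheme \<Rightarrow> ('k, 'n, 'z) module_scheme \<Rightarrow> ('m \<Rightarrow> 'n) set"
  where "linear_maps K M N =
    {h \<in> carrier M \<rightarrow> carrier N.
       (\<forall>x\<in>carrier M. \<forall>y\<in>carrier M. h (x \<oplus>\<^bsub>M\<^esub> y) = h x \<oplus>\<^bsub>N\<^esub> h y) \<and>
       (\<forall>c\<in>carrier K. \<forall>x\<in>carrier M. h (c \<odot>\<^bsub>M\<^esub> x) = c \<odot>\<^bsub>N\<^esub> h x)}"

definition submodule_span :: "'k ring \<Rightarrow> ('k, 'm, 'y) module_scheme \<Rightarrow> 'm set \<Rightarrow> 'm set"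
  where "submodule_span K M S = \<Inter>{H. submodule H K M \<and> S \<subseteq> H}"

text \<open>The records for modules inherit the ring fields \<open>mult\<close> and \<open>one\<close>, which carry no
  meaning for a module and are left undefined.\<close>

definition quot_module :: "('k, 'm, 'y) module_scheme \<Rightarrow> 'm set \<Rightarrow> ('k, 'm set) module"
  where "quot_module M H =
    \<lparr>carrier = a_rcosets\<^bsub>M\<^esub> H, mult = undefined, one = undefined,
     zero = H, add = set_add M,
     smult = (\<lambda>c C. \<Union>x\<in>C. H +>\<^bsub>M\<^esub> (c \<odot>\<^bsub>M\<^esub> x))\<rparr>"


section \<open>Direct sums, free modules, tensor products\<close>

definition direct_sum :: "'i set \<Rightarrow> ('i \<Rightarrow> ('k, 'm) module) \<Rightarrow> ('k, 'i \<Rightarrow> 'm) module"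
  where "direct_sum I G =
    \<lparr>carrier = {v \<in> \<Pi>\<^sub>E i\<in>I. carrier (G i). finite {i \<in> I. v i \<noteq> \<zero>\<^bsub>G i\<^esub>}},
     mult = undefined, one = undefined,
     zero = (\<lambda>i\<in>I. \<zero>\<^bsub>G i\<^esub>),
     add = (\<lambda>v w. \<lambda>i\<in>I. v i \<oplus>\<^bsub>G i\<^esub> w i),
     smult = (\<lambda>c v. \<lambda>i\<in>I. c \<odot>\<^bsub>G i\<^esub> v i)\<rparr>"

definition direct_sum_inj :: "'i set \<Rightarrow> ('i \<Rightarrow> ('k, 'm) module) \<Rightarrow> 'i \<Rightarrow> 'm \<Rightarrow> 'i \<Rightarrow> 'm"
  where "direct_sum_inj I G i v = (\<lambda>j\<in>I. if j = i then v else \<zero>\<^bsub>G j\<^esub>)"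

definition regular_module :: "'k ring \<Rightarrow> ('k, 'k) module"
  where "regular_module K =
    \<lparr>carrier = carrier K, mult = mult K, one = \<one>\<^bsub>K\<^esub>, zero = \<zero>\<^bsub>K\<^esub>, add = add K, smult = mult K\<rparr>"

definition free_module :: "'k ring \<Rightarrow> 'x set \<Rightarrow> ('k, 'x \<Rightarrow> 'k) module"
  where "free_module K X = direct_sum X (\<lambda>_. regular_module K)"

definition free_basis :: "'k ring \<Rightarrow> 'x set \<Rightarrow> 'x \<Rightarrow> 'x \<Rightarrow> 'k"
  where "free_basis K X x = direct_sum_inj X (\<lambda>_. regular_module K) x \<one>\<^bsub>K\<^esub>"

definition bilinear_relations ::
  "'k ring \<Rightarrow> ('k, 'm) module \<Rightarrow> ('k, 'n) module \<Rightarrow> ('m \<times> 'n \<Rightarrow> 'k) set"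
  where "bilinear_relations K M N =
    (let B = carrier M \<times> carrier N; F = free_module K B; e = free_basis K B in
      {e (u \<oplus>\<^bsub>M\<^esub> u', v) \<ominus>\<^bsub>F\<^esub> (e (u, v) \<oplus>\<^bsub>F\<^esub> e (u', v)) | u u' v.
         u \<in> carrier M \<and> u' \<in> carrier M \<and> v \<in> carrier N} \<union>
      {e (u, v \<oplus>\<^bsub>N\<^esub> v') \<ominus>\<^bsub>F\<^esub> (e (u, v) \<oplus>\<^bsub>F\<^esub> e (u, v')) | u v v'.
         u \<in> carrier M \<and> v \<in> carrier N \<and> v' \<in> carrier N} \<union>
      {e (c \<odot>\<^bsub>M\<^esub> u, v) \<ominus>\<^bsub>F\<^esub> c \<odot>\<^bsub>F\<^esub> e (u, v) | c u v.
         c \<in> carrier K \<and> u \<in> carrier M \<and> v \<in> carrier N} \<union>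
      {e (u, c \<odot>\<^bsub>N\<^esub> v) \<ominus>\<^bsub>F\<^esub> c \<odot>\<^bsub>F\<^esub> e (u, v) | c u v.
         c \<in> carrier K \<and> u \<in> carrier M \<and> v \<in> carrier N})"

definition tensor_product ::
  "'k ring \<Rightarrow> ('k, 'm) module \<Rightarrow> ('k, 'n) module \<Rightarrow> ('k, ('m \<times> 'n \<Rightarrow> 'k) set) module"
  where "tensor_product K M N =
    (let F = free_module K (carrier M \<times> carrier N)
     in quot_module F (submodule_span K F (bilinear_relations K M N)))"

definition tensor ::
  "'k ring \<Rightarrow> ('k, 'm) module \<Rightarrow> ('k, 'n) module \<Rightarrow> 'm \<Rightarrow> 'n \<Rightarrow> ('m \<times> 'n \<Rightarrow> 'k) set"
  where "tensor K M N u v =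
    (let B = carrier M \<times> carrier N; F = free_module K B
     in submodule_span K F (bilinear_relations K M N) +>\<^bsub>F\<^esub> free_basis K B (u, v))"

text \<open>An iterated binary tensor product would have a type depending on \<open>n\<close>.  The power
  \<open>M\<^sup>\<otimes>\<^sup>n\<close> is therefore built in one step, from \<open>n\<close>-tuples (lists of length \<open>n\<close>) modulo
  linearity in each position.\<close>

definition tuples :: "('k, 'm) module \<Rightarrow> nat \<Rightarrow> 'm list set"
  where "tuples M n = {us. length us = n \<and> set us \<subseteq> carrier M}"

definition multilinear_relations :: "'k ring \<Rightarrow> ('k, 'm) module \<Rightarrow> nat \<Rightarrow> ('m list \<Rightarrow> 'k) set"
  where "multilinear_relations K M n =
    (let B = tuples M n; F = free_module K B; e = free_basis K B in
      {e (us[i := u \<oplus>\<^bsub>M\<^esub> u']) \<ominus>\<^bsub>F\<^esub> (e (us[i := u]) \<oplus>\<^bsub>F\<^esub> e (us[i := u'])) | us i u u'.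
         us \<in> B \<and> i < n \<and> u \<in> carrier M \<and> u' \<in> carrier M} \<union>
      {e (us[i := c \<odot>\<^bsub>M\<^esub> u]) \<ominus>\<^bsub>F\<^esub> c \<odot>\<^bsub>F\<^esub> e (us[i := u]) | us i c u.
         us \<in> B \<and> i < n \<and> c \<in> carrier K \<and> u \<in> carrier M})"

definition tensor_power :: "'k ring \<Rightarrow> ('k, 'm) module \<Rightarrow> nat \<Rightarrow> ('k, ('m list \<Rightarrow> 'k) set) module"
  where "tensor_power K M n =
    (let F = free_module K (tuples M n)
     in quot_module F (submodule_span K F (multilinear_relations K M n)))"

definition tensor_list :: "'k ring \<Rightarrow> ('k, 'm) module \<Rightarrow> 'm list \<Rightarrow> ('m list \<Rightarrow> 'k) set"
  where "tensor_list K M us =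
    (let B = tuples M (length us); F = free_module K B
     in submodule_span K F (multilinear_relations K M (length us)) +>\<^bsub>F\<^esub> free_basis K B us)"


section \<open>Nijenhuis algebras and their left modules\<close>

text \<open>The library locale \<open>algebra\<close> requires commutativity.\<close>

locale assoc_algebra = module K A + ring A
  for K :: "'k ring" and A :: "('k, 'a) module" +
  assumes smult_mult_left:
      "\<lbrakk>c \<in> carrier K; a \<in> carrier A; b \<in> carrier A\<rbrakk> \<Longrightarrow>
        (c \<odot>\<^bsub>A\<^esub> a) \<otimes>\<^bsub>A\<^esub> b = c \<odot>\<^bsub>A\<^esub> (a \<otimes>\<^bsub>A\<^esub> b)"
    and smult_mult_right:
      "\<lbrakk>c \<in> carrier K; a \<in> carrier A; b \<in> carrier A\<rbrakk> \<Longrightarrow>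
        a \<otimes>\<^bsub>A\<^esub> (c \<odot>\<^bsub>A\<^esub> b) = c \<odot>\<^bsub>A\<^esub> (a \<otimes>\<^bsub>A\<^esub> b)"

locale nijenhuis_algebra = assoc_algebra K A
  for K :: "'k ring" and A :: "('k, 'a) module" and N :: "'a \<Rightarrow> 'a" +
  assumes N_linear: "N \<in> linear_maps K A A"
    and nijenhuis:
      "\<lbrakk>a \<in> carrier A; b \<in> carrier A\<rbrakk> \<Longrightarrow>
        N a \<otimes>\<^bsub>A\<^esub> N b = N (N a \<otimes>\<^bsub>A\<^esub> b \<oplus>\<^bsub>A\<^esub> a \<otimes>\<^bsub>A\<^esub> N b \<ominus>\<^bsub>A\<^esub> N (a \<otimes>\<^bsub>A\<^esub> b))"

record ('k, 'a, 'm) left_module = "('k, 'm) module" +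
  lact :: "'a \<Rightarrow> 'm \<Rightarrow> 'm" (infixl \<open>\<cdot>\<index>\<close> 70)

locale left_alg_module = assoc_algebra K A + M: module K M
  for K :: "'k ring" and A :: "('k, 'a) module" and M :: "('k, 'a, 'm) left_module" +
  assumes lact_closed:
      "\<lbrakk>a \<in> carrier A; m \<in> carrier M\<rbrakk> \<Longrightarrow> a \<cdot>\<^bsub>M\<^esub> m \<in> carrier M"
    and lact_l_distr:
      "\<lbrakk>a \<in> carrier A; b \<in> carrier A; m \<in> carrier M\<rbrakk> \<Longrightarrow>
        (a \<oplus>\<^bsub>A\<^esub> b) \<cdot>\<^bsub>M\<^esub> m = a \<cdot>\<^bsub>M\<^esub> m \<oplus>\<^bsub>M\<^esub> b \<cdot>\<^bsub>M\<^esub> m"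
    and lact_r_distr:
      "\<lbrakk>a \<in> carrier A; m \<in> carrier M; m' \<in> carrier M\<rbrakk> \<Longrightarrow>
        a \<cdot>\<^bsub>M\<^esub> (m \<oplus>\<^bsub>M\<^esub> m') = a \<cdot>\<^bsub>M\<^esub> m \<oplus>\<^bsub>M\<^esub> a \<cdot>\<^bsub>M\<^esub> m'"
    and lact_smult_left:
      "\<lbrakk>c \<in> carrier K; a \<in> carrier A; m \<in> carrier M\<rbrakk> \<Longrightarrow>
        (c \<odot>\<^bsub>A\<^esub> a) \<cdot>\<^bsub>M\<^esub> m = c \<odot>\<^bsub>M\<^esub> (a \<cdot>\<^bsub>M\<^esub> m)"
    and lact_smult_right:
      "\<lbrakk>c \<in> carrier K; a \<in> carrier A; m \<in> carrier M\<rbrakk> \<Longrightarrow>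
        a \<cdot>\<^bsub>M\<^esub> (c \<odot>\<^bsub>M\<^esub> m) = c \<odot>\<^bsub>M\<^esub> (a \<cdot>\<^bsub>M\<^esub> m)"
    and lact_assoc:
      "\<lbrakk>a \<in> carrier A; b \<in> carrier A; m \<in> carrier M\<rbrakk> \<Longrightarrow>
        (a \<otimes>\<^bsub>A\<^esub> b) \<cdot>\<^bsub>M\<^esub> m = a \<cdot>\<^bsub>M\<^esub> (b \<cdot>\<^bsub>M\<^esub> m)"
    and lact_one: "m \<in> carrier M \<Longrightarrow> \<one>\<^bsub>A\<^esub> \<cdot>\<^bsub>M\<^esub> m = m"

locale left_nijenhuis_module = nijenhuis_algebra K A N + left_alg_module K A M
  for K :: "'k ring" and A :: "('k, 'a) module" and N :: "'a \<Rightarrow> 'a"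
    and M :: "('k, 'a, 'm) left_module" and N\<^sub>M :: "'m \<Rightarrow> 'm" +
  assumes N\<^sub>M_linear: "N\<^sub>M \<in> linear_maps K M M"
    and nijenhuis_module:
      "\<lbrakk>a \<in> carrier A; m \<in> carrier M\<rbrakk> \<Longrightarrow>
        N a \<cdot>\<^bsub>M\<^esub> N\<^sub>M m = N\<^sub>M (N a \<cdot>\<^bsub>M\<^esub> m \<oplus>\<^bsub>M\<^esub> a \<cdot>\<^bsub>M\<^esub> N\<^sub>M m \<ominus>\<^bsub>M\<^esub> N\<^sub>M (a \<cdot>\<^bsub>M\<^esub> m))"

definition left_nijenhuis_module_homs ::
  "'k ring \<Rightarrow> ('k, 'a) module \<Rightarrow> ('k, 'a, 'm) left_module \<Rightarrow> ('m \<Rightarrow> 'm) \<Rightarrow>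
   ('k, 'a, 'n) left_module \<Rightarrow> ('n \<Rightarrow> 'n) \<Rightarrow> ('m \<Rightarrow> 'n) set"
  where "left_nijenhuis_module_homs K A M N\<^sub>M M' N\<^sub>M' =
    {h \<in> linear_maps K M M'.
       (\<forall>a\<in>carrier A. \<forall>m\<in>carrier M. h (a \<cdot>\<^bsub>M\<^esub> m) = a \<cdot>\<^bsub>M'\<^esub> h m) \<and>
       (\<forall>m\<in>carrier M. h (N\<^sub>M m) = N\<^sub>M' (h m))}"

text \<open>A formula cannot quantify over types, so the carrier type \<open>'m\<close> of the modules tested
  in the universal property is a parameter; leaving it a type variable in a theorem quantifies
  over all of them.  Restricting to \<open>extensional\<close> maps makes \<open>\<exists>!\<close> mean uniqueness on the
  carrier.\<close>

definition free_left_nijenhuis_module ::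
  "'m itself \<Rightarrow> 'k ring \<Rightarrow> ('k, 'a) module \<Rightarrow> ('a \<Rightarrow> 'a) \<Rightarrow> 'x set \<Rightarrow>
   ('k, 'a, 'f) left_module \<Rightarrow> ('f \<Rightarrow> 'f) \<Rightarrow> ('x \<Rightarrow> 'f) \<Rightarrow> bool"
  where "free_left_nijenhuis_module (T :: 'm itself) K A N X F N\<^sub>F j \<longleftrightarrow>
    left_nijenhuis_module K A N F N\<^sub>F \<and> j \<in> X \<rightarrow> carrier F \<and>
    (\<forall>(M :: ('k, 'a, 'm) left_module) N\<^sub>M f.
       left_nijenhuis_module K A N M N\<^sub>M \<and> f \<in> X \<rightarrow> carrier M \<longrightarrow>
       (\<exists>!h. h \<in> extensional (carrier F) \<and> h \<in> left_nijenhuis_module_homs K A F N\<^sub>F M N\<^sub>M \<and>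
             (\<forall>x\<in>X. h (j x) = f x)))"


section \<open>Operated submodules and quotients\<close>

definition operated_submodule ::
  "'k ring \<Rightarrow> ('k, 'a) module \<Rightarrow> ('k, 'a, 'm) left_module \<Rightarrow> ('m \<Rightarrow> 'm) \<Rightarrow> 'm set \<Rightarrow> bool"
  where "operated_submodule K A M P H \<longleftrightarrow>
    submodule H K M \<and> (\<forall>a\<in>carrier A. \<forall>m\<in>H. a \<cdot>\<^bsub>M\<^esub> m \<in> H) \<and> (\<forall>m\<in>H. P m \<in> H)"

definition operated_span ::
  "'k ring \<Rightarrow> ('k, 'a) module \<Rightarrow> ('k, 'a, 'm) left_module \<Rightarrow> ('m \<Rightarrow> 'm) \<Rightarrow> 'm set \<Rightarrow> 'm set"
  where "operated_span K A M P S = \<Inter>{H. operated_submodule K A M P H \<and> S \<subseteq> H}"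

definition quot_left_module ::
  "('k, 'a, 'm) left_module \<Rightarrow> 'm set \<Rightarrow> ('k, 'a, 'm set) left_module"
  where "quot_left_module M H =
    (let Q = quot_module M H in
     \<lparr>carrier = carrier Q, mult = mult Q, one = one Q, zero = zero Q, add = add Q,
      smult = smult Q, lact = (\<lambda>a C. \<Union>m\<in>C. H +>\<^bsub>M\<^esub> (a \<cdot>\<^bsub>M\<^esub> m))\<rparr>)"

text \<open>\<open>m + H \<mapsto> P m + H\<close>, written as a union over the representatives of the coset.\<close>

definition quot_operator ::
  "('k, 'a, 'm) left_module \<Rightarrow> 'm set \<Rightarrow> ('m \<Rightarrow> 'm) \<Rightarrow> 'm set \<Rightarrow> 'm set"
  where "quot_operator M H P C = (\<Union>m\<in>C. H +>\<^bsub>M\<^esub> P m)"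


section \<open>The construction\<close>

type_synonym ('k, 'a, 'x) MX_elem =
  "nat \<Rightarrow> (('a list \<Rightarrow> 'k) set \<times> ('x \<Rightarrow> 'k) \<Rightarrow> 'k) set"

definition MX_summand ::
  "'k ring \<Rightarrow> ('k, 'a) module \<Rightarrow> 'x set \<Rightarrow> nat \<Rightarrow>
   ('k, (('a list \<Rightarrow> 'k) set \<times> ('x \<Rightarrow> 'k) \<Rightarrow> 'k) set) module"
  where "MX_summand K A X n = tensor_product K (tensor_power K A n) (free_module K X)"

definition MX_module ::
  "'k ring \<Rightarrow> ('k, 'a) module \<Rightarrow> 'x set \<Rightarrow> ('k, ('k, 'a, 'x) MX_elem) module"
  where "MX_module K A X = direct_sum {1..} (MX_summand K A X)"

text \<open>The element \<open>(a\<^sub>1 \<otimes> \<dots> \<otimes> a\<^sub>n) x\<close> for \<open>as = [a\<^sub>1, \<dots>, a\<^sub>n]\<close>.\<close>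

definition MX_tensor ::
  "'k ring \<Rightarrow> ('k, 'a) module \<Rightarrow> 'x set \<Rightarrow> 'a list \<Rightarrow> 'x \<Rightarrow> ('k, 'a, 'x) MX_elem"
  where "MX_tensor K A X as x =
    direct_sum_inj {1..} (MX_summand K A X) (length as)
      (tensor K (tensor_power K A (length as)) (free_module K X)
         (tensor_list K A as) (free_basis K X x))"

text \<open>The elements \<open>(a\<^sub>1 \<otimes> \<dots> \<otimes> a\<^sub>n) x\<close> generate \<open>M(X)\<close> additively, so the additive maps below
  are determined by the values prescribed on them.\<close>

definition MX :: "'k ring \<Rightarrow> ('k, 'a) module \<Rightarrow> 'x set \<Rightarrow> ('k, 'a, ('k, 'a, 'x) MX_elem) left_module"
  where "MX K A X =
    (let M = MX_module K A X in
     \<lparr>carrier = carrier M, mult = mult M, one = one M, zero = zero M, add = add M,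
      smult = smult M,
      lact = (\<lambda>a. THE h. h \<in> extensional (carrier M) \<and> h \<in> hom (add_monoid M) (add_monoid M) \<and>
                (\<forall>b\<in>carrier A. \<forall>bs. set bs \<subseteq> carrier A \<longrightarrow> (\<forall>x\<in>X.
                   h (MX_tensor K A X (b # bs) x) = MX_tensor K A X ((a \<otimes>\<^bsub>A\<^esub> b) # bs) x)))\<rparr>)"

definition PX :: "'k ring \<Rightarrow> ('k, 'a) module \<Rightarrow> 'x set \<Rightarrow> ('k, 'a, 'x) MX_elem \<Rightarrow> ('k, 'a, 'x) MX_elem"
  where "PX K A X =
    (THE h. h \<in> extensional (carrier (MX K A X)) \<and>
       h \<in> hom (add_monoid (MX K A X)) (add_monoid (MX K A X)) \<and>
       (\<forall>as. as \<noteq> [] \<and> set as \<subseteq> carrier A \<longrightarrow> (\<forall>x\<in>X.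
          h (MX_tensor K A X as x) = MX_tensor K A X (\<one>\<^bsub>A\<^esub> # as) x)))"

definition jX :: "'k ring \<Rightarrow> ('k, 'a) module \<Rightarrow> 'x set \<Rightarrow> 'x \<Rightarrow> ('k, 'a, 'x) MX_elem"
  where "jX K A X x = MX_tensor K A X [\<one>\<^bsub>A\<^esub>] x"

definition IX :: "'k ring \<Rightarrow> ('k, 'a) module \<Rightarrow> ('a \<Rightarrow> 'a) \<Rightarrow> 'x set \<Rightarrow> ('k, 'a, 'x) MX_elem set"
  where "IX K A N X =
    (let M = MX K A X; P = PX K A X in
     operated_span K A M P
       {N a \<cdot>\<^bsub>M\<^esub> P m \<ominus>\<^bsub>M\<^esub> P (N a \<cdot>\<^bsub>M\<^esub> m \<oplus>\<^bsub>M\<^esub> a \<cdot>\<^bsub>M\<^esub> P m \<ominus>\<^bsub>M\<^esub> P (a \<cdot>\<^bsub>M\<^esub> m)) | a m.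
          a \<in> carrier A \<and> m \<in> carrier M})"

end

theory Submission
  imports Defs
begin

text \<open>
  Write \<open>W\<close> for \<open>M(X)\<close> and call the elements \<open>(a\<^sub>1 \<otimes> \<dots> \<otimes> a\<^sub>n) x\<close> words.  Before the Nijenhuis
  relation is imposed, \<open>W\<close> is the free left operated \<open>A\<close>-module on \<open>X\<close>: since
  \<open>a \<cdot> P\<^sub>X((a\<^sub>1 \<otimes> \<dots> \<otimes> a\<^sub>n) x) = (a \<otimes> a\<^sub>1 \<otimes> \<dots> \<otimes> a\<^sub>n) x\<close>, a word is
  \<open>a\<^sub>1 \<cdot> P\<^sub>X(a\<^sub>2 \<cdot> P\<^sub>X(\<dots> P\<^sub>X(a\<^sub>n \<cdot> j\<^sub>X(x))))\<close>.  A set map \<open>f\<close> from \<open>X\<close> into a left \<open>A\<close>-module with a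
  linear operator \<open>P\<close> therefore has only one candidate for an extension, sending this word to
  \<open>a\<^sub>1 \<cdot> P(a\<^sub>2 \<cdot> P(\<dots> P(a\<^sub>n \<cdot> f(x))))\<close> (\<open>MX_operated_unique\<close>).  The candidate exists because the
  expression is linear in every \<open>a\<^sub>i\<close>, so that it factors through the tensor powers
  (\<open>MX_operated_lift\<close>).

  \<open>I\<^sub>X\<close> is the smallest operated submodule that contains the defects of the Nijenhuis identity.
  Hence the quotient by \<open>I\<^sub>X\<close> satisfies the identity.  If the target is a left \<open>(A, N)\<close>-module, the
  kernel of the extension of \<open>f\<close> is an operated submodule that contains all defects, thus contains
  \<open>I\<^sub>X\<close>, and the extension descends to the quotient.  Two homomorphisms out of the quotient that agree
  on \<open>X\<close> agree after composition with the projection, hence are equal.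

  Everything about \<open>W\<close> rests on two facts.  The words span it (\<open>words_span\<close>), and any family of maps
  that is multilinear in the letters extends to a linear map on it (\<open>MX_lift\<close>).  Both come down to the
  corresponding facts for quotients, direct sums, free modules, tensor products and tensor powers,
  each of which is treated through its universal property and a spanning set.  The action of
  \<open>A\<close> on \<open>W\<close> and the operator \<open>P\<^sub>X\<close>, which are specified only as additive maps with given values on
  words, are obtained from the same two facts (\<open>lact_MX\<close>, \<open>PX_word\<close>).
\<close>

section \<open>Linear maps and spanning sets\<close>

lemma (in abelian_group) diff_zero: "x \<in> carrier G \<Longrightarrow> x \<ominus> \<zero> = x"
  by (simp add: minus_eq add.inv_one)

lemma (in abelian_group) diff_eq_zero_iff:
  "\<lbrakk>x \<in> carrier G; y \<in> carrier G\<rbrakk> \<Longrightarrow> x \<ominus> y = \<zero> \<longleftrightarrow> x = y"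
  by (metis add.inv_closed add.inv_equality add.inv_inv minus_eq r_neg)

lemma linear_mapsI:
  assumes "\<And>x. x \<in> carrier M \<Longrightarrow> h x \<in> carrier L"
    and "\<And>x y. \<lbrakk>x \<in> carrier M; y \<in> carrier M\<rbrakk> \<Longrightarrow> h (x \<oplus>\<^bsub>M\<^esub> y) = h x \<oplus>\<^bsub>L\<^esub> h y"
    and "\<And>c x. \<lbrakk>c \<in> carrier K; x \<in> carrier M\<rbrakk> \<Longrightarrow> h (c \<odot>\<^bsub>M\<^esub> x) = c \<odot>\<^bsub>L\<^esub> h x"
  shows "h \<in> linear_maps K M L"
  using assms by (auto simp: linear_maps_def)

lemma linear_maps_closed: "\<lbrakk>h \<in> linear_maps K M L; x \<in> carrier M\<rbrakk> \<Longrightarrow> h x \<in> carrier L"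
  by (auto simp: linear_maps_def)

lemma linear_maps_add:
  "\<lbrakk>h \<in> linear_maps K M L; x \<in> carrier M; y \<in> carrier M\<rbrakk> \<Longrightarrow> h (x \<oplus>\<^bsub>M\<^esub> y) = h x \<oplus>\<^bsub>L\<^esub> h y"
  by (auto simp: linear_maps_def)

lemma linear_maps_smult:
  "\<lbrakk>h \<in> linear_maps K M L; c \<in> carrier K; x \<in> carrier M\<rbrakk> \<Longrightarrow> h (c \<odot>\<^bsub>M\<^esub> x) = c \<odot>\<^bsub>L\<^esub> h x"
  by (auto simp: linear_maps_def)

lemma linear_maps_zero:
  assumes "module K M" "module K L" "h \<in> linear_maps K M L"
  shows "h \<zero>\<^bsub>M\<^esub> = \<zero>\<^bsub>L\<^esub>"
proof -
  interpret M: module K M by fact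
  interpret L: module K L by fact
  have "h (\<zero>\<^bsub>K\<^esub> \<odot>\<^bsub>M\<^esub> \<zero>\<^bsub>M\<^esub>) = \<zero>\<^bsub>K\<^esub> \<odot>\<^bsub>L\<^esub> h \<zero>\<^bsub>M\<^esub>"
    by (intro linear_maps_smult[OF assms(3)]) auto
  then show ?thesis using linear_maps_closed[OF assms(3), of "\<zero>\<^bsub>M\<^esub>"] by simp
qed

lemma linear_maps_minus:
  assumes "module K M" "module K L" "h \<in> linear_maps K M L" "x \<in> carrier M" "y \<in> carrier M"
  shows "h (x \<ominus>\<^bsub>M\<^esub> y) = h x \<ominus>\<^bsub>L\<^esub> h y"
proof -
  interpret M: module K M by fact
  interpret L: module K L by fact
  have "h x = h ((x \<ominus>\<^bsub>M\<^esub> y) \<oplus>\<^bsub>M\<^esub> y)"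
    using assms(4,5) by (simp add: M.minus_eq M.a_assoc M.l_neg)
  also have "\<dots> = h (x \<ominus>\<^bsub>M\<^esub> y) \<oplus>\<^bsub>L\<^esub> h y"
    using assms by (intro linear_maps_add[OF assms(3)]) auto
  finally show ?thesis
    using linear_maps_closed[OF assms(3)] assms(4,5)
    by (simp add: L.minus_eq L.a_assoc L.r_neg)
qed

text \<open>Negatives come for free as multiples by \<open>-1\<close>.\<close>

lemma submodule_criterion:
  assumes "module K M" and "H \<subseteq> carrier M" and "\<zero>\<^bsub>M\<^esub> \<in> H"
    and add: "\<And>x y. \<lbrakk>x \<in> H; y \<in> H\<rbrakk> \<Longrightarrow> x \<oplus>\<^bsub>M\<^esub> y \<in> H"
    and smult: "\<And>c x. \<lbrakk>c \<in> carrier K; x \<in> H\<rbrakk> \<Longrightarrow> c \<odot>\<^bsub>M\<^esub> x \<in> H"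
  shows "submodule H K M"
proof -
  interpret M: module K M by fact
  show ?thesis
  proof (rule M.submoduleI)
    fix a assume a: "a \<in> H"
    have "(\<ominus>\<^bsub>K\<^esub> \<one>\<^bsub>K\<^esub>) \<odot>\<^bsub>M\<^esub> a \<in> H" using smult a by simp
    then show "\<ominus>\<^bsub>M\<^esub> a \<in> H" using a assms(2) by (simp add: M.smult_l_minus subset_iff)
  qed (use assms in auto)
qed

lemma submodule_subset: "submodule H K M \<Longrightarrow> H \<subseteq> carrier M"
  using subgroup.subset[of H "add_monoid M"] by (simp add: submodule_def)

lemma submodule_zero: "submodule H K M \<Longrightarrow> \<zero>\<^bsub>M\<^esub> \<in> H"
  using subgroup.one_closed[of H "add_monoid M"] by (simp add: submodule_def)

lemma submodule_add: "submodule H K M \<Longrightarrow> x \<in> H \<Longrightarrow> y \<in> H \<Longrightarrow> x \<oplus>\<^bsub>M\<^esub> y \<in> H"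
  using subgroup.m_closed[of H "add_monoid M" x y] by (simp add: submodule_def)

lemma submodule_smult:
  "submodule H K M \<Longrightarrow> c \<in> carrier K \<Longrightarrow> x \<in> H \<Longrightarrow> c \<odot>\<^bsub>M\<^esub> x \<in> H"
  by (rule submodule.smult_closed)

lemma equalizer_submodule:
  assumes "module K M" "module K L" "f \<in> linear_maps K M L" "g \<in> linear_maps K M L"
  shows "submodule {x \<in> carrier M. f x = g x} K M"
proof -
  interpret M: module K M by fact
  show ?thesis
    using assms by (intro submodule_criterion[OF assms(1)])
      (auto simp: linear_maps_zero linear_maps_add linear_maps_smult)
qed

lemma preimage_submodule:
  assumes "module K M" "module K L" "f \<in> linear_maps K M L" "submodule H K L"
  shows "submodule {x \<in> carrier M. f x \<in> H} K M"
proof -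
  interpret M: module K M by fact
  show ?thesis
    using assms by (intro submodule_criterion[OF assms(1)])
      (auto simp: linear_maps_zero linear_maps_add linear_maps_smult
        submodule_zero submodule_add submodule_smult)
qed

lemma kernel_submodule:
  assumes "module K M" "module K L" "f \<in> linear_maps K M L"
  shows "submodule {x \<in> carrier M. f x = \<zero>\<^bsub>L\<^esub>} K M"
proof -
  interpret M: module K M by fact
  interpret L: module K L by fact
  show ?thesis
    using assms by (intro submodule_criterion[OF assms(1)])
      (auto simp: linear_maps_zero linear_maps_add linear_maps_smult)
qed

lemma span_submodule:
  assumes "module K M" "S \<subseteq> carrier M"
  shows "submodule (submodule_span K M S) K M"
proof -
  have c: "submodule (carrier M) K M" by (rule module.carrier_is_submodule[OF assms(1)])
  show ?thesis
  proof (rule submodule_criterion[OF assms(1)])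
    show "submodule_span K M S \<subseteq> carrier M"
      using c assms(2) by (auto simp: submodule_span_def)
  qed (auto simp: submodule_span_def submodule_zero submodule_add submodule_smult)
qed

lemma span_generator: "x \<in> S \<Longrightarrow> x \<in> submodule_span K M S"
  by (auto simp: submodule_span_def)

lemma span_minimal: "\<lbrakk>submodule H K M; S \<subseteq> H\<rbrakk> \<Longrightarrow> submodule_span K M S \<subseteq> H"
  by (auto simp: submodule_span_def)

lemma module_cong:
  assumes "module K M" "carrier M' = carrier M" "zero M' = zero M" "add M' = add M"
    "smult M' = smult M"
  shows "module K M'"
proof -
  interpret M: module K M by fact
  show ?thesis
  proof (rule moduleI)
    show "abelian_group M'"
      by (rule abelian_groupI)
        (auto simp: assms M.a_ac intro: bexI[of _ "\<ominus>\<^bsub>M\<^esub> _"] M.l_neg)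
  qed (auto simp: assms M.smult_l_distr M.smult_r_distr M.smult_assoc1 M.R.cring_axioms)
qed

lemma submodule_cong:
  assumes "module K M" "carrier M' = carrier M" "zero M' = zero M" "add M' = add M"
    "smult M' = smult M" "submodule H K M'"
  shows "submodule H K M"
  using submodule_subset[OF assms(6)] submodule_zero[OF assms(6)] submodule_add[OF assms(6)]
    submodule_smult[OF assms(6)]
  by (intro submodule_criterion[OF assms(1)]) (auto simp: assms)

text \<open>Stated as an elimination principle: to prove a property of all elements it suffices that the
  elements with the property form a submodule containing \<open>S\<close>.  This form replaces inductions over
  linear combinations.\<close>

definition spans :: "'k ring \<Rightarrow> ('k, 'm, 'y) module_scheme \<Rightarrow> 'm set \<Rightarrow> bool"
  where "spans K M S \<longleftrightarrow> S \<subseteq> carrier M \<and> (\<forall>H. submodule H K M \<longrightarrow> S \<subseteq> H \<longrightarrow> carrier M \<subseteq> H)"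

lemma spansI:
  "\<lbrakk>S \<subseteq> carrier M; \<And>H x. \<lbrakk>submodule H K M; S \<subseteq> H; x \<in> carrier M\<rbrakk> \<Longrightarrow> x \<in> H\<rbrakk> \<Longrightarrow> spans K M S"
  by (auto simp: spans_def)

lemma spansD: "\<lbrakk>spans K M S; submodule H K M; S \<subseteq> H; x \<in> carrier M\<rbrakk> \<Longrightarrow> x \<in> H"
  by (auto simp: spans_def)

lemma linear_maps_eqI:
  assumes "module K M" "module K L" "spans K M S" "f \<in> linear_maps K M L" "g \<in> linear_maps K M L"
    and "\<And>s. s \<in> S \<Longrightarrow> f s = g s" and "x \<in> carrier M"
  shows "f x = g x"
  using spansD[OF assms(3) equalizer_submodule[OF assms(1,2,4,5)] _ assms(7)] assms(3,6)
  by (auto simp: spans_def)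

lemma linear_maps_cong:
  assumes "module K M" "f \<in> linear_maps K M L" "\<And>x. x \<in> carrier M \<Longrightarrow> f x = g x"
  shows "g \<in> linear_maps K M L"
proof -
  interpret M: module K M by fact
  show ?thesis
    using assms(2) assms(3)[symmetric] by (auto simp: linear_maps_def Pi_def)
qed

lemma linear_maps_compose:
  "\<lbrakk>f \<in> linear_maps K M L; g \<in> linear_maps K L L'\<rbrakk> \<Longrightarrow> (\<lambda>x. g (f x)) \<in> linear_maps K M L'"
  by (auto simp: linear_maps_def Pi_def)

lemma linear_maps_sum:
  assumes "module K M" "module K L" "f \<in> linear_maps K M L" "g \<in> linear_maps K M L"
  shows "(\<lambda>x. f x \<oplus>\<^bsub>L\<^esub> g x) \<in> linear_maps K M L"
proof -
  interpret L: module K L by fact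
  interpret M: module K M by fact
  show ?thesis
    using linear_maps_closed[OF assms(3)] linear_maps_closed[OF assms(4)]
    by (intro linear_mapsI)
      (auto simp: linear_maps_add[OF assms(3)] linear_maps_add[OF assms(4)]
        linear_maps_smult[OF assms(3)] linear_maps_smult[OF assms(4)] L.smult_r_distr L.a_ac)
qed

lemma linear_maps_scale:
  assumes "module K M" "module K L" "f \<in> linear_maps K M L" "c \<in> carrier K"
  shows "(\<lambda>x. c \<odot>\<^bsub>L\<^esub> f x) \<in> linear_maps K M L"
proof -
  interpret L: module K L by fact
  interpret M: module K M by fact
  show ?thesis
    using linear_maps_closed[OF assms(3)] assms(4)
    by (intro linear_mapsI)
      (auto simp: linear_maps_add[OF assms(3)] linear_maps_smult[OF assms(3)] L.smult_r_distr
        L.smult_assoc1[symmetric] L.R.m_comm)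
qed

text \<open>Pull a submodule containing the image back along \<open>f\<close>.\<close>

lemma spans_image:
  assumes "module K M" "module K L" "spans K M S" "f \<in> linear_maps K M L"
    and "f ` carrier M = carrier L"
  shows "spans K L (f ` S)"
proof (rule spansI)
  show "f ` S \<subseteq> carrier L" using assms(3,5) by (auto simp: spans_def)
  fix H y assume H: "submodule H K L" "f ` S \<subseteq> H" and "y \<in> carrier L"
  then obtain x where x: "x \<in> carrier M" "y = f x" using assms(5) by blast
  have "x \<in> {x \<in> carrier M. f x \<in> H}"
    using H(2) assms(3)
    by (intro spansD[OF assms(3) preimage_submodule[OF assms(1,2,4) H(1)] _ x(1)])
      (auto simp: spans_def)
  then show "y \<in> H" using x by simp
qed


section \<open>Quotient modules\<close>

locale module_quotient = module K M
  for K :: "'k ring" and M :: "('k, 'm, 'y) module_scheme" (structure) +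
  fixes H :: "'m set"
  assumes submod: "submodule H K M"
begin

lemma abelian_subgroup: "abelian_subgroup H M"
  using submod
  by (intro abelian_subgroupI3 additive_subgroup.intro M.abelian_group_axioms)
    (auto simp: submodule_def)

lemma coset_mem_iff:
  "\<lbrakk>x \<in> carrier M; y \<in> carrier M\<rbrakk> \<Longrightarrow> y \<in> H +> x \<longleftrightarrow> y \<ominus> x \<in> H"
  using abelian_subgroup.a_rcos_module[OF abelian_subgroup] by (simp add: a_minus_def)

lemma coset_subset: "x \<in> carrier M \<Longrightarrow> y \<in> H +> x \<Longrightarrow> y \<in> carrier M"
  using abelian_subgroup.a_elemrcos_carrier[OF abelian_subgroup] by blast

lemma coset_self: "x \<in> carrier M \<Longrightarrow> x \<in> H +> x"
  by (rule abelian_subgroup.a_rcos_self[OF abelian_subgroup])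

lemma coset_eq_iff:
  assumes "x \<in> carrier M" "y \<in> carrier M"
  shows "H +> x = H +> y \<longleftrightarrow> x \<ominus> y \<in> H"
  using abelian_subgroup.a_repr_independence'[OF abelian_subgroup, of x y]
    coset_self[OF assms(1)] coset_mem_iff[OF assms(2,1)] assms(2) by auto

lemma coset_zero_iff: "x \<in> carrier M \<Longrightarrow> H +> x = H \<longleftrightarrow> x \<in> H"
  using coset_eq_iff[of x \<zero>] abelian_subgroup.a_rcos_const[OF abelian_subgroup, of \<zero>]
    submodule_zero[OF submod]
  by (simp add: M.diff_zero)

text \<open>Maps on a quotient are defined as unions over all representatives of a coset. As soon as
  the class of the value is independent of the representative, the union collapses to one
  coset.\<close>

lemma coset_union:
  assumes f: "\<And>y. y \<in> carrier M \<Longrightarrow> f y \<in> carrier M"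
    and cong: "\<And>y. \<lbrakk>y \<in> carrier M; y \<ominus> x \<in> H\<rbrakk> \<Longrightarrow> f y \<ominus> f x \<in> H"
    and x: "x \<in> carrier M"
  shows "(\<Union>y\<in>H +> x. H +> f y) = H +> f x"
proof -
  have "H +> f y = H +> f x" if "y \<in> H +> x" for y
    using that coset_subset[OF x that] coset_mem_iff[OF x] f x by (simp add: coset_eq_iff cong)
  then show ?thesis using coset_self[OF x] by blast
qed

lemma quot_carrier: "carrier (quot_module M H) = (\<lambda>x. H +> x) ` carrier M"
  by (auto simp: quot_module_def A_RCOSETS_def' )

lemma quot_zero: "\<zero>\<^bsub>quot_module M H\<^esub> = H +> \<zero>"
  using coset_zero_iff[of \<zero>] submodule_zero[OF submod] by (simp add: quot_module_def)

lemma quot_add: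
  "\<lbrakk>x \<in> carrier M; y \<in> carrier M\<rbrakk> \<Longrightarrow>
    (H +> x) \<oplus>\<^bsub>quot_module M H\<^esub> (H +> y) = H +> (x \<oplus> y)"
  using abelian_subgroup.a_rcos_sum[OF abelian_subgroup] by (simp add: quot_module_def)

lemma quot_smult:
  assumes "c \<in> carrier K" "x \<in> carrier M"
  shows "c \<odot>\<^bsub>quot_module M H\<^esub> (H +> x) = H +> (c \<odot> x)"
proof -
  have "(\<Union>y\<in>H +> x. H +> (c \<odot> y)) = H +> (c \<odot> x)"
  proof (rule coset_union)
    fix y assume y: "y \<in> carrier M" "y \<ominus> x \<in> H"
    have "c \<odot> y \<ominus> c \<odot> x = c \<odot> (y \<ominus> x)"
      using assms y by (simp add: M.minus_eq smult_r_distr smult_r_minus)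
    then show "c \<odot> y \<ominus> c \<odot> x \<in> H" using submodule_smult[OF submod assms(1) y(2)] by simp
  qed (use assms in auto)
  then show ?thesis by (simp add: quot_module_def)
qed

lemma quot_is_module: "module K (quot_module M H)"
proof (rule moduleI)
  show "abelian_group (quot_module M H)"
  proof (rule abelian_groupI)
    fix x assume "x \<in> carrier (quot_module M H)"
    then obtain m where m: "m \<in> carrier M" "x = H +> m" by (auto simp: quot_carrier)
    then show "\<exists>y\<in>carrier (quot_module M H). y \<oplus>\<^bsub>quot_module M H\<^esub> x = \<zero>\<^bsub>quot_module M H\<^esub>"
      by (intro bexI[of _ "H +> (\<ominus> m)"]) (auto simp: quot_add quot_zero quot_carrier M.l_neg)
  qed (auto simp: quot_carrier quot_add quot_zero M.a_ac)
qed (auto simp: quot_carrier quot_add quot_smult smult_l_distr smult_r_distr smult_assoc1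
      R.cring_axioms)

lemma quot_proj_linear: "(\<lambda>x. H +> x) \<in> linear_maps K M (quot_module M H)"
  by (rule linear_mapsI) (auto simp: quot_carrier quot_add quot_smult)

lemma quot_spans: "spans K M S \<Longrightarrow> spans K (quot_module M H) ((\<lambda>x. H +> x) ` S)"
  by (rule spans_image[OF module_axioms quot_is_module _ quot_proj_linear quot_carrier[symmetric]])

lemma quot_lift:
  assumes L: "module K L" and h: "h \<in> linear_maps K M L"
    and kernel: "\<And>x. x \<in> H \<Longrightarrow> h x = \<zero>\<^bsub>L\<^esub>"
  obtains g where "g \<in> linear_maps K (quot_module M H) L"
    and "\<And>x. x \<in> carrier M \<Longrightarrow> g (H +> x) = h x"
proof
  interpret L: module K L by fact
  define g where "g C = h (SOME x. x \<in> C)" for C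
  show g: "g (H +> x) = h x" if x: "x \<in> carrier M" for x
  proof -
    let ?y = "SOME y. y \<in> H +> x"
    have y: "?y \<in> H +> x" by (rule someI[of _ x]) (rule coset_self[OF x])
    have yc: "?y \<in> carrier M" by (rule coset_subset[OF x y])
    have "h ?y \<ominus>\<^bsub>L\<^esub> h x = h (?y \<ominus> x)"
      using linear_maps_minus[OF module_axioms L h yc x] by simp
    also have "\<dots> = \<zero>\<^bsub>L\<^esub>" using y coset_mem_iff[OF x yc] kernel by simp
    finally show ?thesis
      using linear_maps_closed[OF h] x yc by (simp add: g_def L.diff_eq_zero_iff)
  qed
  show "g \<in> linear_maps K (quot_module M H) L"
    using linear_maps_closed[OF h] linear_maps_add[OF h] linear_maps_smult[OF h]
    by (intro linear_mapsI) (auto simp: quot_carrier quot_add quot_smult g)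
qed

end

section \<open>Direct sums and free modules\<close>

locale module_family =
  fixes K :: "'k ring" and I :: "'i set" and G :: "'i \<Rightarrow> ('k, 'm) module"
  assumes K_cring: "cring K" and family: "i \<in> I \<Longrightarrow> module K (G i)"
begin

lemma direct_sum_carrier:
  "v \<in> carrier (direct_sum I G) \<longleftrightarrow>
    v \<in> extensional I \<and> (\<forall>i\<in>I. v i \<in> carrier (G i)) \<and> finite {i \<in> I. v i \<noteq> \<zero>\<^bsub>G i\<^esub>}"
  by (auto simp: direct_sum_def PiE_def)

lemma direct_sum_ops:
  "\<zero>\<^bsub>direct_sum I G\<^esub> = (\<lambda>i\<in>I. \<zero>\<^bsub>G i\<^esub>)"
  "v \<oplus>\<^bsub>direct_sum I G\<^esub> w = (\<lambda>i\<in>I. v i \<oplus>\<^bsub>G i\<^esub> w i)"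
  "c \<odot>\<^bsub>direct_sum I G\<^esub> v = (\<lambda>i\<in>I. c \<odot>\<^bsub>G i\<^esub> v i)"
  by (simp_all add: direct_sum_def)

lemma family_ops:
  assumes "i \<in> I"
  shows "abelian_group (G i)" "\<zero>\<^bsub>G i\<^esub> \<in> carrier (G i)"
    "x \<in> carrier (G i) \<Longrightarrow> y \<in> carrier (G i) \<Longrightarrow> x \<oplus>\<^bsub>G i\<^esub> y \<in> carrier (G i)"
    "c \<in> carrier K \<Longrightarrow> x \<in> carrier (G i) \<Longrightarrow> c \<odot>\<^bsub>G i\<^esub> x \<in> carrier (G i)"
    "x \<in> carrier (G i) \<Longrightarrow> \<zero>\<^bsub>G i\<^esub> \<oplus>\<^bsub>G i\<^esub> x = x"
    "x \<in> carrier (G i) \<Longrightarrow> x \<oplus>\<^bsub>G i\<^esub> \<zero>\<^bsub>G i\<^esub> = x"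
    "c \<in> carrier K \<Longrightarrow> c \<odot>\<^bsub>G i\<^esub> \<zero>\<^bsub>G i\<^esub> = \<zero>\<^bsub>G i\<^esub>"
proof -
  interpret module K "G i" by (rule family[OF assms])
  show "abelian_group (G i)" "\<zero>\<^bsub>G i\<^esub> \<in> carrier (G i)"
    "x \<in> carrier (G i) \<Longrightarrow> y \<in> carrier (G i) \<Longrightarrow> x \<oplus>\<^bsub>G i\<^esub> y \<in> carrier (G i)"
    "c \<in> carrier K \<Longrightarrow> x \<in> carrier (G i) \<Longrightarrow> c \<odot>\<^bsub>G i\<^esub> x \<in> carrier (G i)"
    "x \<in> carrier (G i) \<Longrightarrow> \<zero>\<^bsub>G i\<^esub> \<oplus>\<^bsub>G i\<^esub> x = x"
    "x \<in> carrier (G i) \<Longrightarrow> x \<oplus>\<^bsub>G i\<^esub> \<zero>\<^bsub>G i\<^esub> = x"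
    "c \<in> carrier K \<Longrightarrow> c \<odot>\<^bsub>G i\<^esub> \<zero>\<^bsub>G i\<^esub> = \<zero>\<^bsub>G i\<^esub>"
    by (auto intro: M.abelian_group_axioms)
qed

lemma direct_sum_add_closed:
  assumes "v \<in> carrier (direct_sum I G)" "w \<in> carrier (direct_sum I G)"
  shows "v \<oplus>\<^bsub>direct_sum I G\<^esub> w \<in> carrier (direct_sum I G)"
proof -
  let ?u = "\<lambda>i\<in>I. v i \<oplus>\<^bsub>G i\<^esub> w i"
  have "{i \<in> I. ?u i \<noteq> \<zero>\<^bsub>G i\<^esub>} \<subseteq> {i \<in> I. v i \<noteq> \<zero>\<^bsub>G i\<^esub>} \<union> {i \<in> I. w i \<noteq> \<zero>\<^bsub>G i\<^esub>}"
    by (auto simp: family_ops)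
  then have "finite {i \<in> I. ?u i \<noteq> \<zero>\<^bsub>G i\<^esub>}"
    by (rule finite_subset) (use assms in \<open>auto simp: direct_sum_carrier\<close>)
  then show ?thesis using assms by (simp add: direct_sum_carrier direct_sum_ops(2) family_ops)
qed

lemma direct_sum_smult_closed:
  assumes "c \<in> carrier K" "v \<in> carrier (direct_sum I G)"
  shows "c \<odot>\<^bsub>direct_sum I G\<^esub> v \<in> carrier (direct_sum I G)"
proof -
  let ?u = "\<lambda>i\<in>I. c \<odot>\<^bsub>G i\<^esub> v i"
  have "{i \<in> I. ?u i \<noteq> \<zero>\<^bsub>G i\<^esub>} \<subseteq> {i \<in> I. v i \<noteq> \<zero>\<^bsub>G i\<^esub>}"
    using assms(1) by (auto simp: family_ops)
  then have "finite {i \<in> I. ?u i \<noteq> \<zero>\<^bsub>G i\<^esub>}"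
    by (rule finite_subset) (use assms in \<open>auto simp: direct_sum_carrier\<close>)
  then show ?thesis using assms by (simp add: direct_sum_carrier direct_sum_ops(3) family_ops)
qed

lemma direct_sum_is_module: "module K (direct_sum I G)"
proof (rule moduleI)
  show "cring K" by (rule K_cring)
  show "abelian_group (direct_sum I G)"
  proof (rule abelian_groupI)
    show "\<zero>\<^bsub>direct_sum I G\<^esub> \<in> carrier (direct_sum I G)"
      by (simp add: direct_sum_carrier direct_sum_ops(1) family_ops cong: conj_cong)
  next
    fix x y z
    assume "x \<in> carrier (direct_sum I G)" "y \<in> carrier (direct_sum I G)"
      "z \<in> carrier (direct_sum I G)"
    then show "x \<oplus>\<^bsub>direct_sum I G\<^esub> y \<oplus>\<^bsub>direct_sum I G\<^esub> z =
        x \<oplus>\<^bsub>direct_sum I G\<^esub> (y \<oplus>\<^bsub>direct_sum I G\<^esub> z)"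
      by (auto simp: direct_sum_carrier direct_sum_ops fun_eq_iff
          abelian_monoid.a_assoc[OF abelian_group.axioms(1)[OF family_ops(1)]])
  next
    fix x y
    assume "x \<in> carrier (direct_sum I G)" "y \<in> carrier (direct_sum I G)"
    then show "x \<oplus>\<^bsub>direct_sum I G\<^esub> y = y \<oplus>\<^bsub>direct_sum I G\<^esub> x"
      by (auto simp: direct_sum_carrier direct_sum_ops fun_eq_iff
          abelian_monoid.a_comm[OF abelian_group.axioms(1)[OF family_ops(1)]])
  next
    fix x assume x: "x \<in> carrier (direct_sum I G)"
    then show "\<zero>\<^bsub>direct_sum I G\<^esub> \<oplus>\<^bsub>direct_sum I G\<^esub> x = x"
      by (auto simp: direct_sum_carrier direct_sum_ops fun_eq_iff family_ops extensional_def)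
    have "(\<ominus>\<^bsub>K\<^esub> \<one>\<^bsub>K\<^esub>) \<odot>\<^bsub>G i\<^esub> x i \<oplus>\<^bsub>G i\<^esub> x i = \<zero>\<^bsub>G i\<^esub>" if "i \<in> I" for i
    proof -
      interpret module K "G i" by (rule family[OF that])
      show ?thesis using x that by (simp add: direct_sum_carrier smult_l_minus M.l_neg)
    qed
    then have "((\<ominus>\<^bsub>K\<^esub> \<one>\<^bsub>K\<^esub>) \<odot>\<^bsub>direct_sum I G\<^esub> x) \<oplus>\<^bsub>direct_sum I G\<^esub> x = \<zero>\<^bsub>direct_sum I G\<^esub>"
      by (auto simp: direct_sum_ops fun_eq_iff)
    moreover have "\<ominus>\<^bsub>K\<^esub> \<one>\<^bsub>K\<^esub> \<in> carrier K"
      by (simp add: K_cring cring.axioms(1) ring.is_abelian_group abelian_group.a_inv_closed ring.ring_simprules(6))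
    ultimately show "\<exists>y\<in>carrier (direct_sum I G). y \<oplus>\<^bsub>direct_sum I G\<^esub> x = \<zero>\<^bsub>direct_sum I G\<^esub>"
      using direct_sum_smult_closed[OF _ x] by blast
  qed (rule direct_sum_add_closed)
  show "c \<odot>\<^bsub>direct_sum I G\<^esub> x \<in> carrier (direct_sum I G)"
    if "c \<in> carrier K" "x \<in> carrier (direct_sum I G)" for c x
    using that by (rule direct_sum_smult_closed)
qed (auto simp: direct_sum_carrier direct_sum_ops fun_eq_iff extensional_def
    module.smult_l_distr[OF family] module.smult_r_distr[OF family]
    module.smult_assoc1[OF family] module.smult_one[OF family])

lemma direct_sum_inj_closed:
  assumes "i \<in> I" "v \<in> carrier (G i)"
  shows "direct_sum_inj I G i v \<in> carrier (direct_sum I G)"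
proof -
  let ?u = "\<lambda>j\<in>I. if j = i then v else \<zero>\<^bsub>G j\<^esub>"
  have "finite {j \<in> I. ?u j \<noteq> \<zero>\<^bsub>G j\<^esub>}" by (rule finite_subset[of _ "{i}"]) auto
  then show ?thesis
    using assms by (auto simp: direct_sum_carrier direct_sum_inj_def family_ops)
qed

lemma direct_sum_inj_linear:
  assumes "i \<in> I"
  shows "direct_sum_inj I G i \<in> linear_maps K (G i) (direct_sum I G)"
proof (rule linear_mapsI)
  show "direct_sum_inj I G i v \<in> carrier (direct_sum I G)" if "v \<in> carrier (G i)" for v
    using assms that by (rule direct_sum_inj_closed)
qed (auto simp: assms direct_sum_inj_def direct_sum_ops family_ops fun_eq_iff)

lemma direct_sum_spans:
  assumes S: "\<And>i. i \<in> I \<Longrightarrow> spans K (G i) (S i)"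
  shows "spans K (direct_sum I G) (\<Union>i\<in>I. direct_sum_inj I G i ` S i)"
proof (rule spansI)
  show "(\<Union>i\<in>I. direct_sum_inj I G i ` S i) \<subseteq> carrier (direct_sum I G)"
    using S direct_sum_inj_closed by (fastforce simp: spans_def)
  fix H x
  assume H: "submodule H K (direct_sum I G)" "(\<Union>i\<in>I. direct_sum_inj I G i ` S i) \<subseteq> H"
    and "x \<in> carrier (direct_sum I G)"
  have inj: "direct_sum_inj I G i v \<in> H" if "i \<in> I" "v \<in> carrier (G i)" for i v
  proof -
    have "v \<in> {v \<in> carrier (G i). direct_sum_inj I G i v \<in> H}"
      using H(2) S[OF that(1)] that(1)
      by (intro spansD[OF S[OF that(1)] preimage_submodule[OF family[OF that(1)]
              direct_sum_is_module direct_sum_inj_linear[OF that(1)] H(1)] _ that(2)])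
        (auto simp: spans_def)
    then show ?thesis by simp
  qed
  \<comment> \<open>Peel off the entries of \<open>x\<close> one at a time.\<close>
  have "x \<in> H" if "finite F" "x \<in> carrier (direct_sum I G)" "{i \<in> I. x i \<noteq> \<zero>\<^bsub>G i\<^esub>} = F" for F x
    using that
  proof (induction F arbitrary: x rule: finite_induct)
    case empty
    then have "x = \<zero>\<^bsub>direct_sum I G\<^esub>"
      by (auto simp: direct_sum_ops direct_sum_carrier extensional_def fun_eq_iff)
    then show ?case using submodule_zero[OF H(1)] by simp
  next
    case (insert k F)
    let ?y = "\<lambda>i\<in>I. if i = k then \<zero>\<^bsub>G i\<^esub> else x i"
    have k: "k \<in> I" using insert.prems by blast
    have supp: "{i \<in> I. ?y i \<noteq> \<zero>\<^bsub>G i\<^esub>} = F" using insert by auto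
    have xc: "\<And>i. i \<in> I \<Longrightarrow> x i \<in> carrier (G i)" "x \<in> extensional I"
      using insert.prems by (auto simp: direct_sum_carrier)
    have "?y \<in> carrier (direct_sum I G)"
      unfolding direct_sum_carrier supp using insert.hyps xc by (auto simp: family_ops)
    then have "?y \<in> H" using insert.IH supp by blast
    moreover have "x = ?y \<oplus>\<^bsub>direct_sum I G\<^esub> direct_sum_inj I G k (x k)"
      using xc by (auto simp: direct_sum_ops direct_sum_inj_def fun_eq_iff family_ops extensional_def)
    ultimately show ?case
      using submodule_add[OF H(1)] inj[OF k xc(1)[OF k]] by metis
  qed
  then show "x \<in> H" using \<open>x \<in> carrier _\<close> by (auto simp: direct_sum_carrier)
qed

text \<open>The lift is the sum of the \<open>h i (v i)\<close> over the support of \<open>v\<close>.\<close>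

lemma direct_sum_lift:
  assumes L: "module K L" and h: "\<And>i. i \<in> I \<Longrightarrow> h i \<in> linear_maps K (G i) L"
  obtains g where "g \<in> linear_maps K (direct_sum I G) L"
    and "\<And>i v. \<lbrakk>i \<in> I; v \<in> carrier (G i)\<rbrakk> \<Longrightarrow> g (direct_sum_inj I G i v) = h i v"
proof
  interpret L: module K L by fact
  let ?supp = "\<lambda>v. {i \<in> I. v i \<noteq> \<zero>\<^bsub>G i\<^esub>}"
  define g where "g v = (\<Oplus>\<^bsub>L\<^esub>i\<in>?supp v. h i (v i))" for v
  have h0: "h i \<zero>\<^bsub>G i\<^esub> = \<zero>\<^bsub>L\<^esub>" if "i \<in> I" for i
    using linear_maps_zero[OF family L h] that by blast
  have hc: "h i v \<in> carrier L" if "i \<in> I" "v \<in> carrier (G i)" for i v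
    using linear_maps_closed[OF h] that by blast
  \<comment> \<open>The sum may be taken over any larger finite index set, so that the supports of two
    vectors can be replaced by their union.\<close>
  have gS: "g v = (\<Oplus>\<^bsub>L\<^esub>i\<in>S. h i (v i))"
    if "finite S" "S \<subseteq> I" "?supp v \<subseteq> S" "\<And>i. i \<in> I \<Longrightarrow> v i \<in> carrier (G i)" for v S
    unfolding g_def
    by (rule L.add.finprod_mono_neutral_cong_left) (use that h0 hc in auto)
  show "g (direct_sum_inj I G i v) = h i v" if iv: "i \<in> I" "v \<in> carrier (G i)" for i v
  proof -
    have "g (direct_sum_inj I G i v) = (\<Oplus>\<^bsub>L\<^esub>j\<in>{i}. h j (direct_sum_inj I G i v j))"
      by (rule gS) (use iv in \<open>auto simp: direct_sum_inj_def family_ops\<close>)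
    also have "\<dots> = h i v" using iv hc by (simp add: direct_sum_inj_def)
    finally show ?thesis .
  qed
  show "g \<in> linear_maps K (direct_sum I G) L"
  proof (rule linear_mapsI)
    fix v assume v: "v \<in> carrier (direct_sum I G)"
    then show "g v \<in> carrier L"
      unfolding g_def using hc by (intro L.finsum_closed) (auto simp: direct_sum_carrier)
    fix w assume w: "w \<in> carrier (direct_sum I G)"
    let ?S = "?supp v \<union> ?supp w" and ?u = "v \<oplus>\<^bsub>direct_sum I G\<^esub> w"
    have u: "?u \<in> carrier (direct_sum I G)" by (rule direct_sum_add_closed[OF v w])
    have S: "finite ?S" "?S \<subseteq> I" using v w by (auto simp: direct_sum_carrier)
    have c: "v i \<in> carrier (G i)" "w i \<in> carrier (G i)" "?u i \<in> carrier (G i)" if "i \<in> I" for i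
      using v w u that by (auto simp: direct_sum_carrier)
    have "g ?u = (\<Oplus>\<^bsub>L\<^esub>i\<in>?S. h i (?u i))"
      by (rule gS[OF S]) (use c in \<open>auto simp: direct_sum_ops family_ops\<close>)
    also have "\<dots> = (\<Oplus>\<^bsub>L\<^esub>i\<in>?S. h i (v i) \<oplus>\<^bsub>L\<^esub> h i (w i))"
      using c hc by (intro L.finsum_cong') (auto simp: direct_sum_ops linear_maps_add[OF h])
    also have "\<dots> = (\<Oplus>\<^bsub>L\<^esub>i\<in>?S. h i (v i)) \<oplus>\<^bsub>L\<^esub> (\<Oplus>\<^bsub>L\<^esub>i\<in>?S. h i (w i))"
      using c hc by (intro L.finsum_addf) auto
    also have "\<dots> = g v \<oplus>\<^bsub>L\<^esub> g w" using gS[OF S, of v] gS[OF S, of w] c by simp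
    finally show "g ?u = g v \<oplus>\<^bsub>L\<^esub> g w" .
  next
    fix c v assume c: "c \<in> carrier K" and v: "v \<in> carrier (direct_sum I G)"
    let ?u = "c \<odot>\<^bsub>direct_sum I G\<^esub> v"
    have u: "?u \<in> carrier (direct_sum I G)" by (rule direct_sum_smult_closed[OF c v])
    have vc: "v i \<in> carrier (G i)" "?u i \<in> carrier (G i)" if "i \<in> I" for i
      using v u that by (auto simp: direct_sum_carrier)
    have S: "finite (?supp v)" using v by (auto simp: direct_sum_carrier)
    have "g ?u = (\<Oplus>\<^bsub>L\<^esub>i\<in>?supp v. h i (?u i))"
      by (rule gS[OF S]) (use vc c in \<open>auto simp: direct_sum_ops family_ops\<close>)
    also have "\<dots> = (\<Oplus>\<^bsub>L\<^esub>i\<in>?supp v. c \<odot>\<^bsub>L\<^esub> h i (v i))"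
      using vc hc c by (intro L.finsum_cong') (auto simp: direct_sum_ops linear_maps_smult[OF h])
    also have "\<dots> = c \<odot>\<^bsub>L\<^esub> g v"
      unfolding g_def using vc hc c by (intro L.finsum_smult_ldistr[symmetric] S) auto
    finally show "g ?u = c \<odot>\<^bsub>L\<^esub> g v" .
  qed
qed

end

lemma regular_module_is_module:
  assumes "cring K" shows "module K (regular_module K)"
proof -
  interpret K: cring K by fact
  show ?thesis
  proof (rule moduleI[OF assms])
    show "abelian_group (regular_module K)"
      by (rule abelian_groupI)
        (auto simp: regular_module_def K.a_ac intro!: bexI[of _ "\<ominus>\<^bsub>K\<^esub> _"] K.l_neg)
  qed (auto simp: regular_module_def K.l_distr K.r_distr K.m_assoc)
qed

lemma regular_module_spans:
  assumes "cring K" shows "spans K (regular_module K) {\<one>\<^bsub>K\<^esub>}"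
proof -
  interpret K: cring K by fact
  show ?thesis
  proof (rule spansI)
    fix H x
    assume H: "submodule H K (regular_module K)" "{\<one>\<^bsub>K\<^esub>} \<subseteq> H"
      and x: "x \<in> carrier (regular_module K)"
    have "x \<odot>\<^bsub>regular_module K\<^esub> \<one>\<^bsub>K\<^esub> \<in> H"
      using x H(2) by (intro submodule_smult[OF H(1)]) (auto simp: regular_module_def)
    then show "x \<in> H" using x by (simp add: regular_module_def)
  qed (simp add: regular_module_def)
qed


lemma regular_family: "cring K \<Longrightarrow> module_family K X (\<lambda>_. regular_module K)"
  by (auto simp: module_family_def intro: regular_module_is_module)

lemma free_module_is_module: "cring K \<Longrightarrow> module K (free_module K X)"
  unfolding free_module_def by (intro module_family.direct_sum_is_module regular_family)

lemma free_basis_closed: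
  assumes "cring K" "x \<in> X"
  shows "free_basis K X x \<in> carrier (free_module K X)"
proof -
  interpret K: cring K by fact
  interpret module_family K X "\<lambda>_. regular_module K" by (rule regular_family) fact
  show ?thesis
    unfolding free_basis_def free_module_def
    by (intro direct_sum_inj_closed assms) (simp add: regular_module_def)
qed

lemma free_module_spans:
  assumes "cring K" shows "spans K (free_module K X) (free_basis K X ` X)"
proof -
  interpret module_family K X "\<lambda>_. regular_module K" by (rule regular_family) fact
  have "free_basis K X ` X = (\<Union>x\<in>X. direct_sum_inj X (\<lambda>_. regular_module K) x ` {\<one>\<^bsub>K\<^esub>})"
    by (auto simp: free_basis_def)
  then show ?thesis
    unfolding free_module_def by (simp only:) (intro direct_sum_spans regular_module_spans assms)
qed

lemma free_module_lift:
  assumes "module K L" and \<phi>: "\<And>x. x \<in> X \<Longrightarrow> \<phi> x \<in> carrier L"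
  obtains g where "g \<in> linear_maps K (free_module K X) L"
    and "\<And>x. x \<in> X \<Longrightarrow> g (free_basis K X x) = \<phi> x"
proof -
  interpret L: module K L by fact
  interpret module_family K X "\<lambda>_. regular_module K"
    by (rule regular_family) (rule L.R.cring_axioms)
  have h: "(\<lambda>c. c \<odot>\<^bsub>L\<^esub> \<phi> x) \<in> linear_maps K (regular_module K) L" if "x \<in> X" for x
    using \<phi>[OF that]
    by (intro linear_mapsI) (auto simp: regular_module_def L.smult_l_distr L.smult_assoc1)
  show thesis
  proof (rule direct_sum_lift[OF assms(1) h])
    fix g
    assume g: "g \<in> linear_maps K (direct_sum X (\<lambda>_. regular_module K)) L"
      and gi: "\<And>x c. \<lbrakk>x \<in> X; c \<in> carrier (regular_module K)\<rbrakk> \<Longrightarrow>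
        g (direct_sum_inj X (\<lambda>_. regular_module K) x c) = c \<odot>\<^bsub>L\<^esub> \<phi> x"
    have "\<one>\<^bsub>K\<^esub> \<in> carrier (regular_module K)" by (simp add: regular_module_def)
    then show thesis
      using g by (intro that[of g]) (simp_all add: free_module_def free_basis_def gi \<phi>)
  qed
qed

section \<open>Modules given by generators and relations\<close>

text \<open>Both tensor products and tensor powers are quotients of a free module by the span of a set of
  relations, so their universal properties are instances of the one proved here.\<close>

locale presentation =
  fixes K :: "'k ring" and B :: "'b set" and R :: "('b \<Rightarrow> 'k) set"
  assumes K_cring: "cring K" and relations_subset: "R \<subseteq> carrier (free_module K B)"
begin

abbreviation F where "F \<equiv> free_module K B"
abbreviation J where "J \<equiv> submodule_span K F R"
abbreviation Q where "Q \<equiv> quot_module F J"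
abbreviation cls where "cls b \<equiv> J +>\<^bsub>F\<^esub> free_basis K B b"

sublocale F: module K F
  by (rule free_module_is_module[OF K_cring])

sublocale Q: module_quotient K F J
  by (intro module_quotient.intro module_quotient_axioms.intro F.module_axioms
      span_submodule relations_subset)

lemma basis_closed: "b \<in> B \<Longrightarrow> free_basis K B b \<in> carrier F"
  by (rule free_basis_closed[OF K_cring])

lemma gen_closed: "b \<in> B \<Longrightarrow> cls b \<in> carrier Q"
  using basis_closed by (auto simp: Q.quot_carrier)

lemma gen_spans: "spans K Q (cls ` B)"
  using Q.quot_spans[OF free_module_spans[OF K_cring]] by (simp add: image_image)

text \<open>The linear extension of \<open>\<phi>\<close> to the free module has a submodule as its kernel, so it
  vanishes on the span of the relations as soon as it vanishes on the relations.\<close>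

lemma gen_lift:
  assumes L: "module K L" and \<phi>: "\<And>b. b \<in> B \<Longrightarrow> \<phi> b \<in> carrier L"
    and kernel: "\<And>g r. \<lbrakk>g \<in> linear_maps K F L; \<And>b. b \<in> B \<Longrightarrow> g (free_basis K B b) = \<phi> b; r \<in> R\<rbrakk>
      \<Longrightarrow> g r = \<zero>\<^bsub>L\<^esub>"
  obtains h where "h \<in> linear_maps K Q L" and "\<And>b. b \<in> B \<Longrightarrow> h (cls b) = \<phi> b"
proof (rule free_module_lift[OF L \<phi>])
  fix g
  assume g: "g \<in> linear_maps K F L" and gb: "\<And>b. b \<in> B \<Longrightarrow> g (free_basis K B b) = \<phi> b"
  have "submodule {x \<in> carrier F. g x = \<zero>\<^bsub>L\<^esub>} K F"
    by (rule kernel_submodule[OF F.module_axioms L g])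
  then have "J \<subseteq> {x \<in> carrier F. g x = \<zero>\<^bsub>L\<^esub>}"
    using kernel[OF g gb] relations_subset by (intro span_minimal) auto
  then have "\<And>x. x \<in> J \<Longrightarrow> g x = \<zero>\<^bsub>L\<^esub>" by auto
  then show thesis
  proof (rule Q.quot_lift[OF L g])
    fix h
    assume "h \<in> linear_maps K Q L" and "\<And>x. x \<in> carrier F \<Longrightarrow> h (J +>\<^bsub>F\<^esub> x) = g x"
    then show thesis
      using gb basis_closed by (intro that[of h]) auto
  qed
qed assumption

lemma relation_coset:
  "\<lbrakk>x \<in> carrier F; y \<in> carrier F; x \<ominus>\<^bsub>F\<^esub> y \<in> R\<rbrakk> \<Longrightarrow> J +>\<^bsub>F\<^esub> x = J +>\<^bsub>F\<^esub> y"
  by (simp add: Q.coset_eq_iff span_generator)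

lemma relation_add:
  assumes "b \<in> B" "b1 \<in> B" "b2 \<in> B"
    and "free_basis K B b \<ominus>\<^bsub>F\<^esub> (free_basis K B b1 \<oplus>\<^bsub>F\<^esub> free_basis K B b2) \<in> R"
  shows "cls b = cls b1 \<oplus>\<^bsub>Q\<^esub> cls b2"
  using relation_coset[OF _ _ assms(4)] assms(1-3) basis_closed
  by (simp add: Q.quot_add)

lemma relation_smult:
  assumes "b \<in> B" "b1 \<in> B" "c \<in> carrier K"
    and "free_basis K B b \<ominus>\<^bsub>F\<^esub> c \<odot>\<^bsub>F\<^esub> free_basis K B b1 \<in> R"
  shows "cls b = c \<odot>\<^bsub>Q\<^esub> cls b1"
  using relation_coset[OF _ _ assms(4)] assms(1-3) basis_closed
  by (simp add: Q.quot_smult)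

lemma kernel_add:
  assumes L: "module K L" and g: "g \<in> linear_maps K F L"
    and "b \<in> B" "b1 \<in> B" "b2 \<in> B"
    and "g (free_basis K B b) = g (free_basis K B b1) \<oplus>\<^bsub>L\<^esub> g (free_basis K B b2)"
  shows "g (free_basis K B b \<ominus>\<^bsub>F\<^esub> (free_basis K B b1 \<oplus>\<^bsub>F\<^esub> free_basis K B b2)) = \<zero>\<^bsub>L\<^esub>"
proof -
  interpret L: module K L by fact
  show ?thesis
    using assms(3-6) basis_closed linear_maps_closed[OF g]
    by (simp add: linear_maps_minus[OF F.module_axioms L g] linear_maps_add[OF g] L.diff_eq_zero_iff)
qed

lemma kernel_smult:
  assumes L: "module K L" and g: "g \<in> linear_maps K F L"
    and "b \<in> B" "b1 \<in> B" "c \<in> carrier K"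
    and "g (free_basis K B b) = c \<odot>\<^bsub>L\<^esub> g (free_basis K B b1)"
  shows "g (free_basis K B b \<ominus>\<^bsub>F\<^esub> c \<odot>\<^bsub>F\<^esub> free_basis K B b1) = \<zero>\<^bsub>L\<^esub>"
proof -
  interpret L: module K L by fact
  show ?thesis
    using assms(3-6) basis_closed linear_maps_closed[OF g]
    by (simp add: linear_maps_minus[OF F.module_axioms L g] linear_maps_smult[OF g] L.diff_eq_zero_iff)
qed

end


section \<open>Tensor products\<close>

locale tensor_pair = M: module K M + N: module K N
  for K :: "'k ring" and M :: "('k, 'm) module" and N :: "('k, 'n) module"
begin

sublocale P: presentation K "carrier M \<times> carrier N" "bilinear_relations K M N"
proof (rule presentation.intro)
  show "cring K" by (rule M.R.cring_axioms)
  interpret F: module K "free_module K (carrier M \<times> carrier N)"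
    by (rule free_module_is_module[OF M.R.cring_axioms])
  show "bilinear_relations K M N \<subseteq> carrier (free_module K (carrier M \<times> carrier N))"
    unfolding bilinear_relations_def Let_def
    by (auto intro!: F.minus_closed F.M.a_closed F.smult_closed free_basis_closed M.R.cring_axioms)
qed

lemma bilinear_relationsI:
  "\<lbrakk>x \<in> carrier M; y \<in> carrier M; v \<in> carrier N\<rbrakk> \<Longrightarrow>
    free_basis K (carrier M \<times> carrier N) (x \<oplus>\<^bsub>M\<^esub> y, v) \<ominus>\<^bsub>P.F\<^esub>
      (free_basis K (carrier M \<times> carrier N) (x, v) \<oplus>\<^bsub>P.F\<^esub>
       free_basis K (carrier M \<times> carrier N) (y, v)) \<in> bilinear_relations K M N"
  "\<lbrakk>u \<in> carrier M; z \<in> carrier N; w \<in> carrier N\<rbrakk> \<Longrightarrow>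
    free_basis K (carrier M \<times> carrier N) (u, z \<oplus>\<^bsub>N\<^esub> w) \<ominus>\<^bsub>P.F\<^esub>
      (free_basis K (carrier M \<times> carrier N) (u, z) \<oplus>\<^bsub>P.F\<^esub>
       free_basis K (carrier M \<times> carrier N) (u, w)) \<in> bilinear_relations K M N"
  "\<lbrakk>c \<in> carrier K; x \<in> carrier M; v \<in> carrier N\<rbrakk> \<Longrightarrow>
    free_basis K (carrier M \<times> carrier N) (c \<odot>\<^bsub>M\<^esub> x, v) \<ominus>\<^bsub>P.F\<^esub>
      c \<odot>\<^bsub>P.F\<^esub> free_basis K (carrier M \<times> carrier N) (x, v) \<in> bilinear_relations K M N"
  "\<lbrakk>c \<in> carrier K; u \<in> carrier M; z \<in> carrier N\<rbrakk> \<Longrightarrow>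
    free_basis K (carrier M \<times> carrier N) (u, c \<odot>\<^bsub>N\<^esub> z) \<ominus>\<^bsub>P.F\<^esub>
      c \<odot>\<^bsub>P.F\<^esub> free_basis K (carrier M \<times> carrier N) (u, z) \<in> bilinear_relations K M N"
  unfolding bilinear_relations_def Let_def by blast+

lemma tensor_eq: "tensor K M N u v = P.cls (u, v)"
  by (simp add: tensor_def Let_def)

lemma tensor_product_eq: "tensor_product K M N = P.Q"
  by (simp add: tensor_product_def Let_def)

lemma tensor_product_is_module: "module K (tensor_product K M N)"
  unfolding tensor_product_eq by (rule P.Q.quot_is_module)

lemma tensor_closed:
  "\<lbrakk>u \<in> carrier M; v \<in> carrier N\<rbrakk> \<Longrightarrow> tensor K M N u v \<in> carrier (tensor_product K M N)"
  by (simp add: tensor_eq tensor_product_eq P.gen_closed)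

lemma tensor_linear_left:
  assumes "v \<in> carrier N"
  shows "(\<lambda>u. tensor K M N u v) \<in> linear_maps K M (tensor_product K M N)"
proof (rule linear_mapsI)
  show "tensor K M N (x \<oplus>\<^bsub>M\<^esub> y) v =
      tensor K M N x v \<oplus>\<^bsub>tensor_product K M N\<^esub> tensor K M N y v"
    if "x \<in> carrier M" "y \<in> carrier M" for x y
    unfolding tensor_eq tensor_product_eq
    using that assms
    by (intro P.relation_add) (simp_all add: bilinear_relationsI)
  show "tensor K M N (c \<odot>\<^bsub>M\<^esub> x) v = c \<odot>\<^bsub>tensor_product K M N\<^esub> tensor K M N x v"
    if "c \<in> carrier K" "x \<in> carrier M" for c x
    unfolding tensor_eq tensor_product_eq
    using that assms
    by (intro P.relation_smult) (simp_all add: bilinear_relationsI)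
qed (use assms tensor_closed in auto)

lemma tensor_linear_right:
  assumes "u \<in> carrier M"
  shows "tensor K M N u \<in> linear_maps K N (tensor_product K M N)"
proof (rule linear_mapsI)
  show "tensor K M N u (x \<oplus>\<^bsub>N\<^esub> y) =
      tensor K M N u x \<oplus>\<^bsub>tensor_product K M N\<^esub> tensor K M N u y"
    if "x \<in> carrier N" "y \<in> carrier N" for x y
    unfolding tensor_eq tensor_product_eq
    using that assms
    by (intro P.relation_add) (simp_all add: bilinear_relationsI)
  show "tensor K M N u (c \<odot>\<^bsub>N\<^esub> x) = c \<odot>\<^bsub>tensor_product K M N\<^esub> tensor K M N u x"
    if "c \<in> carrier K" "x \<in> carrier N" for c x
    unfolding tensor_eq tensor_product_eq
    using that assms
    by (intro P.relation_smult) (simp_all add: bilinear_relationsI)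
qed (use assms tensor_closed in auto)

text \<open>The vectors \<open>u\<close> with \<open>u \<otimes> t \<in> H\<close> form a submodule, and so do the vectors \<open>v\<close> with
  \<open>u \<otimes> v \<in> H\<close>; the two factors are thus enlarged from \<open>S\<close>, \<open>T\<close> to the whole modules one after
  the other.\<close>

lemma tensor_spans:
  assumes S: "spans K M S" and T: "spans K N T"
  shows "spans K (tensor_product K M N) {tensor K M N s t | s t. s \<in> S \<and> t \<in> T}"
proof (rule spansI)
  have ST: "S \<subseteq> carrier M" "T \<subseteq> carrier N" using S T by (auto simp: spans_def)
  then show "{tensor K M N s t | s t. s \<in> S \<and> t \<in> T} \<subseteq> carrier (tensor_product K M N)"
    using tensor_closed by blast
  fix H x
  assume H: "submodule H K (tensor_product K M N)"
    and sub: "{tensor K M N s t | s t. s \<in> S \<and> t \<in> T} \<subseteq> H"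
    and x: "x \<in> carrier (tensor_product K M N)"
  have 1: "tensor K M N u t \<in> H" if "u \<in> carrier M" "t \<in> T" for u t
  proof -
    have "u \<in> {u \<in> carrier M. tensor K M N u t \<in> H}"
      using sub ST that(2)
      by (intro spansD[OF S preimage_submodule[OF M.module_axioms tensor_product_is_module
              tensor_linear_left H] _ that(1)]) auto
    then show ?thesis by simp
  qed
  have 2: "tensor K M N u v \<in> H" if "u \<in> carrier M" "v \<in> carrier N" for u v
  proof -
    have "v \<in> {v \<in> carrier N. tensor K M N u v \<in> H}"
      using 1 ST that(1)
      by (intro spansD[OF T preimage_submodule[OF N.module_axioms tensor_product_is_module
              tensor_linear_right H] _ that(2)]) auto
    then show ?thesis by simp
  qed
  then have "P.cls ` (carrier M \<times> carrier N) \<subseteq> H" by (auto simp: tensor_eq)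
  then show "x \<in> H"
    by (rule spansD[OF P.gen_spans H[unfolded tensor_product_eq] _ x[unfolded tensor_product_eq]])
qed

lemma tensor_lift:
  assumes L: "module K L"
    and left: "\<And>v. v \<in> carrier N \<Longrightarrow> (\<lambda>u. \<beta> u v) \<in> linear_maps K M L"
    and right: "\<And>u. u \<in> carrier M \<Longrightarrow> \<beta> u \<in> linear_maps K N L"
  obtains h where "h \<in> linear_maps K (tensor_product K M N) L"
    and "\<And>u v. \<lbrakk>u \<in> carrier M; v \<in> carrier N\<rbrakk> \<Longrightarrow> h (tensor K M N u v) = \<beta> u v"
proof (rule P.gen_lift[OF L, where \<phi> = "\<lambda>(u, v). \<beta> u v"])
  show "(case b of (u, v) \<Rightarrow> \<beta> u v) \<in> carrier L" if "b \<in> carrier M \<times> carrier N" for b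
    using that linear_maps_closed[OF left] by auto
  fix h
  assume "h \<in> linear_maps K P.Q L" and "\<And>b. b \<in> carrier M \<times> carrier N \<Longrightarrow>
    h (P.cls b) = (case b of (u, v) \<Rightarrow> \<beta> u v)"
  then show thesis
    by (intro that[of h]) (auto simp: tensor_product_eq tensor_eq)
next
  fix g r
  assume g: "g \<in> linear_maps K P.F L"
    and gb: "\<And>b. b \<in> carrier M \<times> carrier N \<Longrightarrow>
      g (free_basis K (carrier M \<times> carrier N) b) = (case b of (u, v) \<Rightarrow> \<beta> u v)"
    and "r \<in> bilinear_relations K M N"
  then show "g r = \<zero>\<^bsub>L\<^esub>"
    unfolding bilinear_relations_def Let_def
    by (auto intro!: P.kernel_add[OF L g] P.kernel_smult[OF L g]
        simp: gb linear_maps_add[OF left] linear_maps_add[OF right]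
          linear_maps_smult[OF left] linear_maps_smult[OF right])
qed

end


text \<open>For fixed \<open>u\<close> the values \<open>g x u\<close> on the basis extend to a linear map on the free module.  Its
  dependence on \<open>u\<close> is again linear because two linear maps on the free module are equal once they
  agree on the basis.\<close>

lemma tensor_free_lift:
  assumes M: "module K M" and L: "module K L"
    and g: "\<And>x. x \<in> X \<Longrightarrow> g x \<in> linear_maps K M L"
  obtains h where "h \<in> linear_maps K (tensor_product K M (free_module K X)) L"
    and "\<And>u x. \<lbrakk>u \<in> carrier M; x \<in> X\<rbrakk> \<Longrightarrow>
      h (tensor K M (free_module K X) u (free_basis K X x)) = g x u"
proof -
  interpret L: module K L by fact
  interpret M: module K M by fact
  have F: "module K (free_module K X)" by (rule free_module_is_module[OF L.R.cring_axioms])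
  have span: "spans K (free_module K X) (free_basis K X ` X)"
    by (rule free_module_spans[OF L.R.cring_axioms])
  interpret T: tensor_pair K M "free_module K X" by (intro tensor_pair.intro M F)
  have "\<exists>b. b \<in> linear_maps K (free_module K X) L \<and> (\<forall>x\<in>X. b (free_basis K X x) = g x u)"
    if "u \<in> carrier M" for u
    by (rule free_module_lift[OF L, of X "\<lambda>x. g x u"])
      (use linear_maps_closed[OF g that] in auto)
  then obtain \<beta> where \<beta>: "\<And>u. u \<in> carrier M \<Longrightarrow> \<beta> u \<in> linear_maps K (free_module K X) L"
    and \<beta>x: "\<And>u x. \<lbrakk>u \<in> carrier M; x \<in> X\<rbrakk> \<Longrightarrow> \<beta> u (free_basis K X x) = g x u"
    by metis
  have left: "(\<lambda>u. \<beta> u v) \<in> linear_maps K M L" if v: "v \<in> carrier (free_module K X)" for v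
  proof (rule linear_mapsI)
    show "\<beta> u v \<in> carrier L" if "u \<in> carrier M" for u
      by (rule linear_maps_closed[OF \<beta>[OF that] v])
    show "\<beta> (s \<oplus>\<^bsub>M\<^esub> t) v = \<beta> s v \<oplus>\<^bsub>L\<^esub> \<beta> t v" if "s \<in> carrier M" "t \<in> carrier M" for s t
      by (rule linear_maps_eqI[OF F L span \<beta> linear_maps_sum[OF F L \<beta> \<beta>] _ v])
        (use that in \<open>auto simp: \<beta>x linear_maps_add[OF g]\<close>)
    show "\<beta> (c \<odot>\<^bsub>M\<^esub> s) v = c \<odot>\<^bsub>L\<^esub> \<beta> s v" if "c \<in> carrier K" "s \<in> carrier M" for c s
      by (rule linear_maps_eqI[OF F L span \<beta> linear_maps_scale[OF F L \<beta>] _ v])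
        (use that in \<open>auto simp: \<beta>x linear_maps_smult[OF g]\<close>)
  qed
  show thesis
  proof (rule T.tensor_lift[OF L left \<beta>])
    fix h
    assume "h \<in> linear_maps K (tensor_product K M (free_module K X)) L"
      and "\<And>u v. \<lbrakk>u \<in> carrier M; v \<in> carrier (free_module K X)\<rbrakk> \<Longrightarrow>
        h (tensor K M (free_module K X) u v) = \<beta> u v"
    then show thesis
      by (intro that[of h]) (auto simp: \<beta>x free_basis_closed[OF L.R.cring_axioms])
  qed
qed


section \<open>Tensor powers\<close>

text \<open>For \<open>n = 0\<close> there is no position to vary and the second clause is vacuous, so the values are
  required to lie in \<open>L\<close> separately.\<close>

definition multilinear ::
  "'k ring \<Rightarrow> ('k, 'm) module \<Rightarrow> nat \<Rightarrow> ('k, 'l, 'z) module_scheme \<Rightarrow> ('m list \<Rightarrow> 'l) \<Rightarrow> bool"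
  where "multilinear K M n L \<phi> \<longleftrightarrow>
    (\<forall>us\<in>tuples M n. \<phi> us \<in> carrier L) \<and>
    (\<forall>us\<in>tuples M n. \<forall>i<n. (\<lambda>u. \<phi> (us[i := u])) \<in> linear_maps K M L)"

lemma tuples_update: "\<lbrakk>us \<in> tuples M n; u \<in> carrier M\<rbrakk> \<Longrightarrow> us[i := u] \<in> tuples M n"
  using set_update_subset_insert[of us i u] by (auto simp: tuples_def)

lemma multilinear_update:
  "\<lbrakk>multilinear K M n L \<phi>; us \<in> tuples M n; i < n\<rbrakk> \<Longrightarrow>
    (\<lambda>u. \<phi> (us[i := u])) \<in> linear_maps K M L"
  by (simp add: multilinear_def)

lemma multilinear_compose:
  assumes \<phi>: "multilinear K M n L \<phi>" and h: "h \<in> linear_maps K L L'"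
  shows "multilinear K M n L' (\<lambda>us. h (\<phi> us))"
  unfolding multilinear_def
proof (intro conjI ballI allI impI)
  show "h (\<phi> us) \<in> carrier L'" if "us \<in> tuples M n" for us
    using \<phi> that by (intro linear_maps_closed[OF h]) (simp add: multilinear_def)
  show "(\<lambda>u. h (\<phi> (us[i := u]))) \<in> linear_maps K M L'" if "us \<in> tuples M n" "i < n" for us i
    by (rule linear_maps_compose[OF multilinear_update[OF \<phi> that] h])
qed

lemma multilinear_cong:
  assumes "module K M" "multilinear K M n L \<phi>" "\<And>us. us \<in> tuples M n \<Longrightarrow> \<phi> us = \<psi> us"
  shows "multilinear K M n L \<psi>"
  unfolding multilinear_def
proof (intro conjI ballI allI impI)
  fix us i assume us: "us \<in> tuples M n" and i: "i < n"
  show "(\<lambda>u. \<psi> (us[i := u])) \<in> linear_maps K M L"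
    by (rule linear_maps_cong[OF assms(1), of "\<lambda>u. \<phi> (us[i := u])"])
      (use assms us i in \<open>auto simp: multilinear_def tuples_update\<close>)
qed (use assms in \<open>auto simp: multilinear_def\<close>)

locale tensor_power_space = M: module K M
  for K :: "'k ring" and M :: "('k, 'm) module" +
  fixes n :: nat
begin

sublocale P: presentation K "tuples M n" "multilinear_relations K M n"
proof (rule presentation.intro)
  show "cring K" by (rule M.R.cring_axioms)
  interpret F: module K "free_module K (tuples M n)"
    by (rule free_module_is_module[OF M.R.cring_axioms])
  show "multilinear_relations K M n \<subseteq> carrier (free_module K (tuples M n))"
    unfolding multilinear_relations_def Let_def
    by (auto intro!: F.minus_closed F.M.a_closed F.smult_closed free_basis_closed M.R.cring_axioms
        tuples_update)
qed

lemma tensor_list_eq: "us \<in> tuples M n \<Longrightarrow> tensor_list K M us = P.cls us"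
  by (simp add: tensor_list_def Let_def tuples_def)

lemma tensor_power_eq: "tensor_power K M n = P.Q"
  by (simp add: tensor_power_def Let_def)

lemma tensor_power_is_module: "module K (tensor_power K M n)"
  unfolding tensor_power_eq by (rule P.Q.quot_is_module)

lemma tensor_list_closed:
  "us \<in> tuples M n \<Longrightarrow> tensor_list K M us \<in> carrier (tensor_power K M n)"
  by (simp add: tensor_list_eq tensor_power_eq P.gen_closed)

lemma tensor_list_multilinear: "multilinear K M n (tensor_power K M n) (tensor_list K M)"
  unfolding multilinear_def
proof (intro conjI ballI allI impI tensor_list_closed)
  fix us i assume us: "us \<in> tuples M n" and i: "i < n"
  show "(\<lambda>u. tensor_list K M (us[i := u])) \<in> linear_maps K M (tensor_power K M n)"
  proof (rule linear_mapsI)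
    show "tensor_list K M (us[i := x \<oplus>\<^bsub>M\<^esub> y]) =
        tensor_list K M (us[i := x]) \<oplus>\<^bsub>tensor_power K M n\<^esub> tensor_list K M (us[i := y])"
      if xy: "x \<in> carrier M" "y \<in> carrier M" for x y
    proof -
      have "P.cls (us[i := x \<oplus>\<^bsub>M\<^esub> y]) = P.cls (us[i := x]) \<oplus>\<^bsub>P.Q\<^esub> P.cls (us[i := y])"
        using us i xy
        by (intro P.relation_add) (auto simp: tuples_update multilinear_relations_def Let_def)
      then show ?thesis using us xy by (simp add: tensor_list_eq tuples_update tensor_power_eq)
    qed
    show "tensor_list K M (us[i := c \<odot>\<^bsub>M\<^esub> x]) =
        c \<odot>\<^bsub>tensor_power K M n\<^esub> tensor_list K M (us[i := x])"
      if cx: "c \<in> carrier K" "x \<in> carrier M" for c x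
    proof -
      have "P.cls (us[i := c \<odot>\<^bsub>M\<^esub> x]) = c \<odot>\<^bsub>P.Q\<^esub> P.cls (us[i := x])"
        using us i cx
        by (intro P.relation_smult) (auto simp: tuples_update multilinear_relations_def Let_def)
      then show ?thesis using us cx by (simp add: tensor_list_eq tuples_update tensor_power_eq)
    qed
  qed (intro tensor_list_closed tuples_update us)
qed

lemma tensor_list_spans: "spans K (tensor_power K M n) (tensor_list K M ` tuples M n)"
  using P.gen_spans by (simp add: tensor_power_eq tensor_list_eq cong: image_cong)

lemma tensor_power_lift:
  assumes L: "module K L" and \<phi>: "multilinear K M n L \<phi>"
  obtains h where "h \<in> linear_maps K (tensor_power K M n) L"
    and "\<And>us. us \<in> tuples M n \<Longrightarrow> h (tensor_list K M us) = \<phi> us"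
proof (rule P.gen_lift[OF L, where \<phi> = \<phi>])
  show "\<phi> us \<in> carrier L" if "us \<in> tuples M n" for us
    using \<phi> that by (simp add: multilinear_def)
  fix h
  assume "h \<in> linear_maps K P.Q L" and "\<And>us. us \<in> tuples M n \<Longrightarrow> h (P.cls us) = \<phi> us"
  then show thesis
    by (intro that[of h]) (auto simp: tensor_power_eq tensor_list_eq)
next
  fix g r
  assume g: "g \<in> linear_maps K P.F L"
    and gb: "\<And>us. us \<in> tuples M n \<Longrightarrow> g (free_basis K (tuples M n) us) = \<phi> us"
    and r: "r \<in> multilinear_relations K M n"
  have lin: "(\<lambda>u. \<phi> (us[i := u])) \<in> linear_maps K M L" if "us \<in> tuples M n" "i < n" for us i
    using \<phi> that by (simp add: multilinear_def)
  show "g r = \<zero>\<^bsub>L\<^esub>"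
    using r unfolding multilinear_relations_def Let_def
    by (auto intro!: P.kernel_add[OF L g] P.kernel_smult[OF L g]
        simp: gb tuples_update linear_maps_add[OF lin] linear_maps_smult[OF lin])
qed

end

section \<open>Words and the universal property of \<open>M(X)\<close>\<close>

locale MX_setting = assoc_algebra K A
  for K :: "'k ring" and A :: "('k, 'a) module" +
  fixes X :: "'x set"
begin

abbreviation W where "W \<equiv> MX K A X"
abbreviation word where "word \<equiv> MX_tensor K A X"

definition words :: "('k, 'a, 'x) MX_elem set"
  where "words = {word as x | as x. as \<noteq> [] \<and> set as \<subseteq> carrier A \<and> x \<in> X}"

lemma K_cring: "cring K" by (rule R.cring_axioms)

lemma A_module: "module K A" by (rule module_axioms)

lemma tensor_power_A: "tensor_power_space K A"
  by (rule tensor_power_space.intro) (rule A_module)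

lemma summand_pair: "tensor_pair K (tensor_power K A n) (free_module K X)"
  by (intro tensor_pair.intro tensor_power_space.tensor_power_is_module tensor_power_A
      free_module_is_module K_cring)

lemma summand_family: "module_family K {1..} (MX_summand K A X)"
  by (intro module_family.intro K_cring)
    (simp add: MX_summand_def tensor_pair.tensor_product_is_module[OF summand_pair])

lemma MX_module_is_module: "module K (MX_module K A X)"
  unfolding MX_module_def by (rule module_family.direct_sum_is_module[OF summand_family])

lemma MX_fields:
  "carrier W = carrier (MX_module K A X)" "zero W = zero (MX_module K A X)"
  "add W = add (MX_module K A X)" "smult W = smult (MX_module K A X)"
  by (simp_all add: MX_def Let_def)

lemma MX_is_module: "module K W"
  by (rule module_cong[OF MX_module_is_module MX_fields])

lemma linear_maps_MX:
  "linear_maps K W L = linear_maps K (MX_module K A X) L"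
  "linear_maps K L W = linear_maps K L (MX_module K A X)"
  by (simp_all add: linear_maps_def MX_fields)

lemma summand_word_linear:
  assumes "n \<ge> 1" "x \<in> X"
  shows "(\<lambda>t. direct_sum_inj {1..} (MX_summand K A X) n
      (tensor K (tensor_power K A n) (free_module K X) t (free_basis K X x)))
    \<in> linear_maps K (tensor_power K A n) W"
  unfolding linear_maps_MX MX_module_def
proof (rule linear_maps_compose)
  show "(\<lambda>t. tensor K (tensor_power K A n) (free_module K X) t (free_basis K X x))
      \<in> linear_maps K (tensor_power K A n) (MX_summand K A X n)"
    unfolding MX_summand_def
    by (rule tensor_pair.tensor_linear_left[OF summand_pair free_basis_closed[OF K_cring assms(2)]])
  show "direct_sum_inj {1..} (MX_summand K A X) n
      \<in> linear_maps K (MX_summand K A X n) (direct_sum {1..} (MX_summand K A X))"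
    using assms(1) by (intro module_family.direct_sum_inj_linear summand_family) auto
qed

lemma word_multilinear:
  assumes "n \<ge> 1" "x \<in> X"
  shows "multilinear K A n W (\<lambda>as. word as x)"
  by (rule multilinear_cong[OF A_module multilinear_compose[OF
          tensor_power_space.tensor_list_multilinear[OF tensor_power_A] summand_word_linear[OF assms]]])
    (simp add: MX_tensor_def tuples_def)

lemma word_closed:
  assumes "as \<noteq> []" "set as \<subseteq> carrier A" "x \<in> X"
  shows "word as x \<in> carrier W"
  using word_multilinear[of "length as" x] assms
  by (auto simp: multilinear_def tuples_def Suc_le_eq)

lemma word_update_linear:
  assumes "set as \<subseteq> carrier A" "x \<in> X" "i < length as"
  shows "(\<lambda>u. word (as[i := u]) x) \<in> linear_maps K A W"
  using assms by (intro multilinear_update[OF word_multilinear[of "length as" x]])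
    (auto simp: tuples_def Suc_le_eq)

lemma word_head_linear:
  assumes "set as \<subseteq> carrier A" "x \<in> X"
  shows "(\<lambda>u. word (u # as) x) \<in> linear_maps K A W"
  using word_update_linear[of "\<zero>\<^bsub>A\<^esub> # as" x 0] assms by auto

text \<open>The pure tensors formed from spanning sets of the two factors span each summand, and inside
  the \<open>n\<close>-th summand these are the words of length \<open>n\<close>.\<close>

lemma words_span: "spans K W words"
proof -
  let ?S = "\<lambda>n. {tensor K (tensor_power K A n) (free_module K X) s t | s t.
    s \<in> tensor_list K A ` tuples A n \<and> t \<in> free_basis K X ` X}"
  have "spans K (MX_summand K A X n) (?S n)" for n
    unfolding MX_summand_def
    by (rule tensor_pair.tensor_spans[OF summand_pair
          tensor_power_space.tensor_list_spans[OF tensor_power_A] free_module_spans[OF K_cring]])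
  then have *: "spans K (MX_module K A X)
      (\<Union>n\<in>{1..}. direct_sum_inj {1..} (MX_summand K A X) n ` ?S n)"
    unfolding MX_module_def by (intro module_family.direct_sum_spans summand_family)
  have eq: "(\<Union>n\<in>{1..}. direct_sum_inj {1..} (MX_summand K A X) n ` ?S n) \<subseteq> words"
  proof
    fix y assume "y \<in> (\<Union>n\<in>{1..}. direct_sum_inj {1..} (MX_summand K A X) n ` ?S n)"
    then obtain n v where n: "n \<in> {1..}" "y = direct_sum_inj {1..} (MX_summand K A X) n v"
      and "v \<in> ?S n"
      by (elim UN_E imageE)
    then obtain s t where v: "v = tensor K (tensor_power K A n) (free_module K X) s t"
      and s: "s \<in> tensor_list K A ` tuples A n" and t: "t \<in> free_basis K X ` X"
      by (elim CollectE exE conjE)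
    obtain as where as: "as \<in> tuples A n" "s = tensor_list K A as" using s by (rule imageE)
    obtain x where x: "x \<in> X" "t = free_basis K X x" using t by (rule imageE)
    have "y = word as x" "as \<noteq> []" "set as \<subseteq> carrier A"
      using n as(1) by (auto simp: MX_tensor_def tuples_def v as(2) x(2))
    then show "y \<in> words" unfolding words_def using x(1) by blast
  qed
  show ?thesis
  proof (rule spansI)
    show "words \<subseteq> carrier W" by (auto simp: words_def word_closed)
    fix H w assume H: "submodule H K W" "words \<subseteq> H" and w: "w \<in> carrier W"
    show "w \<in> H"
      by (rule spansD[OF * submodule_cong[OF MX_module_is_module MX_fields H(1)]
            subset_trans[OF eq H(2)] w[unfolded MX_fields]])
  qed
qed

text \<open>A map on words is built in the order in which \<open>M(X)\<close> is: for fixed \<open>x\<close> and \<open>n\<close> it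
  factors through the tensor power, the basis elements \<open>x\<close> are collected by \<open>tensor_free_lift\<close>, and
  the lengths \<open>n\<close> by the direct sum.\<close>

lemma MX_lift:
  assumes L: "module K L"
    and \<phi>: "\<And>n x. \<lbrakk>n \<ge> 1; x \<in> X\<rbrakk> \<Longrightarrow> multilinear K A n L (\<lambda>as. \<phi> as x)"
  obtains h where "h \<in> linear_maps K W L"
    and "\<And>as x. \<lbrakk>as \<noteq> []; set as \<subseteq> carrier A; x \<in> X\<rbrakk> \<Longrightarrow> h (word as x) = \<phi> as x"
proof -
  have "\<exists>h. h \<in> linear_maps K (MX_summand K A X n) L \<and>
      (\<forall>as\<in>tuples A n. \<forall>x\<in>X. h (tensor K (tensor_power K A n) (free_module K X)
        (tensor_list K A as) (free_basis K X x)) = \<phi> as x)"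
    if n: "n \<in> {1..}" for n
  proof -
    have "\<exists>g. g \<in> linear_maps K (tensor_power K A n) L \<and>
        (\<forall>as\<in>tuples A n. g (tensor_list K A as) = \<phi> as x)" if "x \<in> X" for x
      by (rule tensor_power_space.tensor_power_lift[OF tensor_power_A L \<phi>]) (use n that in auto)
    then obtain g where g: "\<And>x. x \<in> X \<Longrightarrow> g x \<in> linear_maps K (tensor_power K A n) L"
      and g_word: "\<And>x as. \<lbrakk>x \<in> X; as \<in> tuples A n\<rbrakk> \<Longrightarrow> g x (tensor_list K A as) = \<phi> as x"
      by metis
    note T = tensor_power_space.tensor_power_is_module[OF tensor_power_A]
    show ?thesis
      unfolding MX_summand_def
      by (rule tensor_free_lift[OF T L g])
        (use g_word tensor_power_space.tensor_list_closed[OF tensor_power_A] in auto)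
  qed
  then obtain h where
    h: "\<And>n. n \<in> {1..} \<Longrightarrow> h n \<in> linear_maps K (MX_summand K A X n) L"
    and h_word: "\<And>n as x. \<lbrakk>n \<in> {1..}; as \<in> tuples A n; x \<in> X\<rbrakk> \<Longrightarrow>
      h n (tensor K (tensor_power K A n) (free_module K X)
        (tensor_list K A as) (free_basis K X x)) = \<phi> as x"
    by metis
  show thesis
  proof (rule module_family.direct_sum_lift[OF summand_family L h])
    fix g
    assume g: "g \<in> linear_maps K (direct_sum {1..} (MX_summand K A X)) L"
      and gh: "\<And>n v. \<lbrakk>n \<in> {1..}; v \<in> carrier (MX_summand K A X n)\<rbrakk> \<Longrightarrow>
        g (direct_sum_inj {1..} (MX_summand K A X) n v) = h n v"
    show thesis
    proof (rule that)
      show "g \<in> linear_maps K W L" using g by (simp add: linear_maps_MX MX_module_def)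
      fix as x assume as: "as \<noteq> []" "set as \<subseteq> carrier A" and x: "x \<in> X"
      let ?n = "length as"
      have n: "?n \<in> {1..}" "as \<in> tuples A ?n" using as by (auto simp: tuples_def Suc_le_eq)
      have "tensor K (tensor_power K A ?n) (free_module K X)
          (tensor_list K A as) (free_basis K X x) \<in> carrier (MX_summand K A X ?n)"
        unfolding MX_summand_def
        by (intro tensor_pair.tensor_closed[OF summand_pair] free_basis_closed[OF K_cring x]
            tensor_power_space.tensor_list_closed[OF tensor_power_A] n)
      then show "g (word as x) = \<phi> as x"
        using gh[OF n(1)] h_word[OF n x] by (simp add: MX_tensor_def)
    qed
  qed
qed

text \<open>A scalar multiple of a word is again a word, since the scalar can be absorbed into the first
  letter. Hence additive maps, not only linear ones, are determined by their values on
  words.\<close>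

lemma additive_maps_eqI:
  assumes f: "f \<in> hom (add_monoid W) (add_monoid W)" and g: "g \<in> hom (add_monoid W) (add_monoid W)"
    and eq: "\<And>as x. \<lbrakk>as \<noteq> []; set as \<subseteq> carrier A; x \<in> X\<rbrakk> \<Longrightarrow> f (word as x) = g (word as x)"
    and w: "w \<in> carrier W"
  shows "f w = g w"
proof -
  interpret W: module K W by (rule MX_is_module)
  have add: "f (u \<oplus>\<^bsub>W\<^esub> v) = f u \<oplus>\<^bsub>W\<^esub> f v" "g (u \<oplus>\<^bsub>W\<^esub> v) = g u \<oplus>\<^bsub>W\<^esub> g v"
    if "u \<in> carrier W" "v \<in> carrier W" for u v
    using f g that by (auto simp: hom_def)
  have zero: "f \<zero>\<^bsub>W\<^esub> = g \<zero>\<^bsub>W\<^esub>"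
    using hom_one[OF f W.a_group W.a_group] hom_one[OF g W.a_group W.a_group] by simp
  \<comment> \<open>For an additive map the set where \<open>f\<close> and \<open>g\<close> agree need not be closed under scalars; quantifying
    over all multiples of \<open>w\<close> makes it so.\<close>
  let ?E = "{w \<in> carrier W. \<forall>c\<in>carrier K. f (c \<odot>\<^bsub>W\<^esub> w) = g (c \<odot>\<^bsub>W\<^esub> w)}"
  have "submodule ?E K W"
    by (rule submodule_criterion[OF MX_is_module])
      (auto simp: zero W.smult_r_distr add W.smult_assoc1[symmetric])
  moreover have "words \<subseteq> ?E"
  proof (clarsimp simp: words_def word_closed)
    fix as x c
    assume as: "as \<noteq> []" "set as \<subseteq> carrier A" and x: "x \<in> X" and c: "c \<in> carrier K"
    obtain b bs where b: "as = b # bs" using as(1) by (cases as) auto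
    have "c \<odot>\<^bsub>W\<^esub> word as x = word ((c \<odot>\<^bsub>A\<^esub> b) # bs) x"
      using linear_maps_smult[OF word_head_linear, of bs x c b] as x c b by simp
    then show "f (c \<odot>\<^bsub>W\<^esub> word as x) = g (c \<odot>\<^bsub>W\<^esub> word as x)"
      using as b c x by (simp add: eq)
  qed
  ultimately have "w \<in> ?E" using w by (rule spansD[OF words_span])
  then have "f (\<one>\<^bsub>K\<^esub> \<odot>\<^bsub>W\<^esub> w) = g (\<one>\<^bsub>K\<^esub> \<odot>\<^bsub>W\<^esub> w)" by blast
  then show ?thesis using w by simp
qed

lemma linear_maps_MX_hom: "h \<in> linear_maps K W W \<Longrightarrow> h \<in> hom (add_monoid W) (add_monoid W)"
  by (auto simp: hom_def linear_maps_def)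

end

section \<open>\<open>M(X)\<close> as a free left operated module\<close>

context MX_setting
begin

lemma lact_MX_eq:
  "lact W a = (THE h. h \<in> extensional (carrier W) \<and> h \<in> hom (add_monoid W) (add_monoid W) \<and>
    (\<forall>b\<in>carrier A. \<forall>bs. set bs \<subseteq> carrier A \<longrightarrow> (\<forall>x\<in>X.
      h (word (b # bs) x) = word ((a \<otimes>\<^bsub>A\<^esub> b) # bs) x)))"
  by (simp add: MX_def Let_def hom_def)

text \<open>The action of \<open>A\<close> and \<open>P\<^sub>X\<close> are both defined as the unique extensional additive map
  with prescribed values on words; \<open>Q\<close> stands for the prescription.\<close>

lemma additive_map_the_equality:
  assumes h: "h \<in> linear_maps K W W"
    and Q: "Q (restrict h (carrier W))"
    and Q_unique: "\<And>f as x. \<lbrakk>Q f; as \<noteq> []; set as \<subseteq> carrier A; x \<in> X\<rbrakk> \<Longrightarrow>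
      f (word as x) = h (word as x)"
  shows "(THE f. f \<in> extensional (carrier W) \<and> f \<in> hom (add_monoid W) (add_monoid W) \<and> Q f)
    = restrict h (carrier W)"
proof (rule the_equality)
  interpret W: module K W by (rule MX_is_module)
  have "restrict h (carrier W) \<in> hom (add_monoid W) (add_monoid W)"
    using linear_maps_closed[OF h] linear_maps_add[OF h] by (auto simp: hom_def)
  then show "restrict h (carrier W) \<in> extensional (carrier W) \<and>
      restrict h (carrier W) \<in> hom (add_monoid W) (add_monoid W) \<and> Q (restrict h (carrier W))"
    using Q by simp
  fix f
  assume f: "f \<in> extensional (carrier W) \<and> f \<in> hom (add_monoid W) (add_monoid W) \<and> Q f"
  have "f w = h w" if "w \<in> carrier W" for w
    by (rule additive_maps_eqI[OF _ linear_maps_MX_hom[OF h] _ that]) (use f Q_unique in auto)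
  then show "f = restrict h (carrier W)"
    using f by (auto simp: extensional_def fun_eq_iff)
qed

lemma mult_left_linear: "a \<in> carrier A \<Longrightarrow> (\<lambda>u. a \<otimes>\<^bsub>A\<^esub> u) \<in> linear_maps K A A"
  by (rule linear_mapsI) (auto simp: r_distr smult_mult_right)

text \<open>Multiplication of the first letter by \<open>a\<close> and insertion of the letter \<open>1\<close> in front keep a
  word linear in each letter, so both extend to linear operators on \<open>M(X)\<close>.\<close>

lemma lact_MX:
  assumes a: "a \<in> carrier A"
  shows "lact W a \<in> linear_maps K W W"
    and "\<And>b bs x. \<lbrakk>b \<in> carrier A; set bs \<subseteq> carrier A; x \<in> X\<rbrakk> \<Longrightarrow>
      a \<cdot>\<^bsub>W\<^esub> word (b # bs) x = word ((a \<otimes>\<^bsub>A\<^esub> b) # bs) x"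
proof -
  have mult: "multilinear K A n W (\<lambda>as. word (as[0 := a \<otimes>\<^bsub>A\<^esub> as ! 0]) x)"
    if n: "n \<ge> 1" and x: "x \<in> X" for n x
    unfolding multilinear_def
  proof (intro conjI ballI allI impI)
    fix as assume as: "as \<in> tuples A n"
    have hd: "as ! 0 \<in> carrier A" using as n by (cases as) (auto simp: tuples_def)
    have as': "as[0 := a \<otimes>\<^bsub>A\<^esub> as ! 0] \<in> tuples A n" using a as hd by (intro tuples_update) auto
    then show "word (as[0 := a \<otimes>\<^bsub>A\<^esub> as ! 0]) x \<in> carrier W"
      using word_multilinear[OF n x] by (simp add: multilinear_def)
    fix i assume i: "i < n"
    show "(\<lambda>u. word (as[i := u, 0 := a \<otimes>\<^bsub>A\<^esub> as[i := u] ! 0]) x) \<in> linear_maps K A W"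
    proof (cases "i = 0")
      case True
      then show ?thesis
        using as n i linear_maps_compose[OF mult_left_linear[OF a]
            multilinear_update[OF word_multilinear[OF n x] as i]]
        by (simp add: tuples_def)
    next
      case False
      then show ?thesis
        using multilinear_update[OF word_multilinear[OF n x] as' i]
        by (simp add: list_update_swap)
    qed
  qed
  from MX_lift[OF MX_is_module, where \<phi> = "\<lambda>as x. word (as[0 := a \<otimes>\<^bsub>A\<^esub> as ! 0]) x", OF mult] obtain h where h: "h \<in> linear_maps K W W"
    and hw: "\<And>as x. \<lbrakk>as \<noteq> []; set as \<subseteq> carrier A; x \<in> X\<rbrakk> \<Longrightarrow>
      h (word as x) = word (as[0 := a \<otimes>\<^bsub>A\<^esub> as ! 0]) x"
    by blast
  have hw': "h (word (b # bs) x) = word ((a \<otimes>\<^bsub>A\<^esub> b) # bs) x"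
    if "b \<in> carrier A" "set bs \<subseteq> carrier A" "x \<in> X" for b bs x
    using hw[of "b # bs" x] that by simp
  have eq: "lact W a = restrict h (carrier W)"
    unfolding lact_MX_eq
  proof (rule additive_map_the_equality[OF h])
    fix f as x
    assume f: "\<forall>b\<in>carrier A. \<forall>bs. set bs \<subseteq> carrier A \<longrightarrow> (\<forall>x\<in>X.
        f (word (b # bs) x) = word ((a \<otimes>\<^bsub>A\<^esub> b) # bs) x)"
      and as: "as \<noteq> []" "set as \<subseteq> carrier A" "x \<in> X"
    then show "f (word as x) = h (word as x)"
      using hw' by (cases as) auto
  qed (simp add: hw' word_closed)
  show "lact W a \<in> linear_maps K W W"
    unfolding eq by (rule linear_maps_cong[OF MX_is_module h]) simp
  show "a \<cdot>\<^bsub>W\<^esub> word (b # bs) x = word ((a \<otimes>\<^bsub>A\<^esub> b) # bs) x"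
    if "b \<in> carrier A" "set bs \<subseteq> carrier A" "x \<in> X" for b bs x
    using that by (simp add: eq hw' word_closed)
qed

lemma PX_word:
  shows "PX K A X \<in> linear_maps K W W"
    and "\<And>as x. \<lbrakk>as \<noteq> []; set as \<subseteq> carrier A; x \<in> X\<rbrakk> \<Longrightarrow>
      PX K A X (word as x) = word (\<one>\<^bsub>A\<^esub> # as) x"
proof -
  have mult: "multilinear K A n W (\<lambda>as. word (\<one>\<^bsub>A\<^esub> # as) x)"
    if n: "n \<ge> 1" and x: "x \<in> X" for n x
    unfolding multilinear_def
  proof (intro conjI ballI allI impI)
    fix as assume as: "as \<in> tuples A n"
    then show "word (\<one>\<^bsub>A\<^esub> # as) x \<in> carrier W" using x by (intro word_closed) (auto simp: tuples_def)
    fix i assume i: "i < n"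
    show "(\<lambda>u. word (\<one>\<^bsub>A\<^esub> # as[i := u]) x) \<in> linear_maps K A W"
      using word_update_linear[of "\<one>\<^bsub>A\<^esub> # as" x "Suc i"] as x i by (simp add: tuples_def)
  qed
  from MX_lift[OF MX_is_module, where \<phi> = "\<lambda>as x. word (\<one>\<^bsub>A\<^esub> # as) x", OF mult] obtain h where h: "h \<in> linear_maps K W W"
    and hw: "\<And>as x. \<lbrakk>as \<noteq> []; set as \<subseteq> carrier A; x \<in> X\<rbrakk> \<Longrightarrow>
      h (word as x) = word (\<one>\<^bsub>A\<^esub> # as) x"
    by blast
  have eq: "PX K A X = restrict h (carrier W)"
    unfolding PX_def
    by (rule additive_map_the_equality[OF h]) (simp_all add: hw word_closed)
  show "PX K A X \<in> linear_maps K W W"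
    unfolding eq by (rule linear_maps_cong[OF MX_is_module h]) simp
  show "PX K A X (word as x) = word (\<one>\<^bsub>A\<^esub> # as) x"
    if "as \<noteq> []" "set as \<subseteq> carrier A" "x \<in> X" for as x
    using that by (simp add: eq hw word_closed)
qed

lemma linear_maps_eq_on_words:
  assumes "module K L" "f \<in> linear_maps K W L" "g \<in> linear_maps K W L"
    and "\<And>b bs x. \<lbrakk>b \<in> carrier A; set bs \<subseteq> carrier A; x \<in> X\<rbrakk> \<Longrightarrow>
      f (word (b # bs) x) = g (word (b # bs) x)"
    and "w \<in> carrier W"
  shows "f w = g w"
proof (rule linear_maps_eqI[OF MX_is_module assms(1) words_span assms(2,3) _ assms(5)])
  fix s assume "s \<in> words"
  then obtain as x where "s = word as x" "as \<noteq> []" "set as \<subseteq> carrier A" "x \<in> X"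
    by (auto simp: words_def)
  then show "f s = g s" using assms(4) by (cases as) auto
qed

lemma MX_left_alg_module: "left_alg_module K A W"
proof -
  interpret W: module K W by (rule MX_is_module)
  have id: "(\<lambda>w. w) \<in> linear_maps K W W" by (auto simp: linear_maps_def)
  show ?thesis
  proof (intro left_alg_module.intro left_alg_module_axioms.intro MX_is_module)
    show "assoc_algebra K A" by (rule assoc_algebra_axioms)
    show "(a \<oplus>\<^bsub>A\<^esub> b) \<cdot>\<^bsub>W\<^esub> w = a \<cdot>\<^bsub>W\<^esub> w \<oplus>\<^bsub>W\<^esub> b \<cdot>\<^bsub>W\<^esub> w"
      if "a \<in> carrier A" "b \<in> carrier A" "w \<in> carrier W" for a b w
      by (rule linear_maps_eq_on_words[OF MX_is_module lact_MX(1)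
            linear_maps_sum[OF MX_is_module MX_is_module lact_MX(1) lact_MX(1)] _ that(3)])
        (use that in \<open>auto simp: lact_MX l_distr linear_maps_add[OF word_head_linear]\<close>)
    show "(c \<odot>\<^bsub>A\<^esub> a) \<cdot>\<^bsub>W\<^esub> w = c \<odot>\<^bsub>W\<^esub> (a \<cdot>\<^bsub>W\<^esub> w)"
      if "c \<in> carrier K" "a \<in> carrier A" "w \<in> carrier W" for c a w
      by (rule linear_maps_eq_on_words[OF MX_is_module lact_MX(1)
            linear_maps_scale[OF MX_is_module MX_is_module lact_MX(1)] _ that(3)])
        (use that in \<open>auto simp: lact_MX smult_mult_left linear_maps_smult[OF word_head_linear]\<close>)
    show "(a \<otimes>\<^bsub>A\<^esub> b) \<cdot>\<^bsub>W\<^esub> w = a \<cdot>\<^bsub>W\<^esub> (b \<cdot>\<^bsub>W\<^esub> w)"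
      if "a \<in> carrier A" "b \<in> carrier A" "w \<in> carrier W" for a b w
      by (rule linear_maps_eq_on_words[OF MX_is_module lact_MX(1)
            linear_maps_compose[OF lact_MX(1) lact_MX(1)] _ that(3)])
        (use that in \<open>auto simp: lact_MX m_assoc\<close>)
    show "\<one>\<^bsub>A\<^esub> \<cdot>\<^bsub>W\<^esub> w = w" if "w \<in> carrier W" for w
      by (rule linear_maps_eq_on_words[OF MX_is_module lact_MX(1) id _ that]) (auto simp: lact_MX)
  qed (auto simp: linear_maps_closed[OF lact_MX(1)] linear_maps_add[OF lact_MX(1)]
      linear_maps_smult[OF lact_MX(1)])
qed

lemma jX_closed: "x \<in> X \<Longrightarrow> jX K A X x \<in> carrier W"
  by (simp add: jX_def word_closed)

text \<open>The next two lemmas build every word from \<open>j\<^sub>X(x)\<close> by the operator and the action alone, which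
  is why an operated homomorphism is determined by its values on \<open>j\<^sub>X(x)\<close>.\<close>

lemma word_singleton: "\<lbrakk>a \<in> carrier A; x \<in> X\<rbrakk> \<Longrightarrow> word [a] x = a \<cdot>\<^bsub>W\<^esub> jX K A X x"
  by (simp add: jX_def lact_MX)

lemma word_Cons:
  "\<lbrakk>a \<in> carrier A; as \<noteq> []; set as \<subseteq> carrier A; x \<in> X\<rbrakk> \<Longrightarrow>
    word (a # as) x = a \<cdot>\<^bsub>W\<^esub> PX K A X (word as x)"
  by (simp add: PX_word lact_MX)

end

text \<open>The value \<open>a\<^sub>1 \<cdot> P(a\<^sub>2 \<cdot> P(\<dots> P(a\<^sub>n \<cdot> y)))\<close> that an operated homomorphism must give to
  the word \<open>(a\<^sub>1 \<otimes> \<dots> \<otimes> a\<^sub>n) x\<close> when \<open>x\<close> goes to \<open>y\<close>.  There is no \<open>P\<close> between the last letter and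
  \<open>y\<close>; the case distinction takes care of this.\<close>

primrec word_value :: "('a \<Rightarrow> 'l \<Rightarrow> 'l) \<Rightarrow> ('l \<Rightarrow> 'l) \<Rightarrow> 'l \<Rightarrow> 'a list \<Rightarrow> 'l"
  where
    "word_value act P y [] = y"
  | "word_value act P y (a # as) = act a (if as = [] then y else P (word_value act P y as))"

lemma (in left_alg_module) lact_linear:
  "a \<in> carrier A \<Longrightarrow> lact M a \<in> linear_maps K M M"
  "m \<in> carrier M \<Longrightarrow> (\<lambda>a. a \<cdot>\<^bsub>M\<^esub> m) \<in> linear_maps K A M"
  by (auto intro!: linear_mapsI simp: lact_closed lact_l_distr lact_r_distr lact_smult_left
      lact_smult_right)

lemma (in left_alg_module) word_value_multilinear:
  assumes P: "P \<in> linear_maps K M M" and y: "y \<in> carrier M"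
  shows "multilinear K A (Suc n) M (word_value (lact M) P y)"
proof (induction n)
  case 0
  show ?case
    unfolding multilinear_def
    using lact_closed y lact_linear(2)[OF y] by (auto simp: tuples_def length_Suc_conv)
next
  case (Suc n)
  show ?case
    unfolding multilinear_def
  proof (intro conjI ballI allI impI)
    fix us assume us: "us \<in> tuples A (Suc (Suc n))"
    then obtain a as where eq: "us = a # as" and a: "a \<in> carrier A" and as: "as \<in> tuples A (Suc n)"
      by (auto simp: tuples_def length_Suc_conv)
    have ne: "as \<noteq> []" using as by (auto simp: tuples_def)
    let ?v = "word_value (lact M) P y as"
    have v: "P ?v \<in> carrier M"
      using Suc as by (intro linear_maps_closed[OF P]) (simp add: multilinear_def)
    then show "word_value (lact M) P y us \<in> carrier M"
      using a ne by (simp add: eq lact_closed)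
    fix i assume i: "i < Suc (Suc n)"
    show "(\<lambda>u. word_value (lact M) P y (us[i := u])) \<in> linear_maps K A M"
    proof (cases i)
      case 0
      then show ?thesis using lact_linear(2)[OF v] ne by (simp add: eq)
    next
      case (Suc j)
      have "(\<lambda>u. a \<cdot>\<^bsub>M\<^esub> P (word_value (lact M) P y (as[j := u]))) \<in> linear_maps K A M"
        using i Suc
        by (intro linear_maps_compose[OF linear_maps_compose[OF _ P] lact_linear(1)[OF a]]
            multilinear_update[OF Suc.IH as]) auto
      then show ?thesis using ne Suc by (simp add: eq)
    qed
  qed
qed

text \<open>The extension respects the action because \<open>a \<cdot> (a\<^sub>1 \<cdot> v) = (a a\<^sub>1) \<cdot> v\<close>, and the operator
  because inserting the letter \<open>1\<close> in front of a word turns its value \<open>v\<close> into \<open>1 \<cdot> P(v)\<close>.\<close>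

lemma (in MX_setting) MX_operated_lift:
  assumes L: "left_alg_module K A L" and P: "P \<in> linear_maps K L L"
    and f: "\<And>x. x \<in> X \<Longrightarrow> f x \<in> carrier L"
  obtains h where "h \<in> linear_maps K W L"
    and "\<And>a w. \<lbrakk>a \<in> carrier A; w \<in> carrier W\<rbrakk> \<Longrightarrow> h (a \<cdot>\<^bsub>W\<^esub> w) = a \<cdot>\<^bsub>L\<^esub> h w"
    and "\<And>w. w \<in> carrier W \<Longrightarrow> h (PX K A X w) = P (h w)"
    and "\<And>x. x \<in> X \<Longrightarrow> h (jX K A X x) = f x"
proof -
  interpret L: left_alg_module K A L by fact
  have L_module: "module K L" by (rule L.M.module_axioms)
  let ?\<phi> = "\<lambda>as x. word_value (lact L) P (f x) as"
  have mult: "multilinear K A n L (\<lambda>as. ?\<phi> as x)" if "n \<ge> 1" "x \<in> X" for n x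
    using L.word_value_multilinear[OF P f[OF that(2)], of "n - 1"] that(1) by simp
  from MX_lift[OF L_module, where \<phi> = ?\<phi>, OF mult] obtain h where h: "h \<in> linear_maps K W L"
    and hw: "\<And>as x. \<lbrakk>as \<noteq> []; set as \<subseteq> carrier A; x \<in> X\<rbrakk> \<Longrightarrow> h (word as x) = ?\<phi> as x"
    by blast
  have cl: "?\<phi> bs x \<in> carrier L" if "set bs \<subseteq> carrier A" "x \<in> X" for bs x
    using linear_maps_closed[OF h word_closed[of bs x]] hw[of bs x] f that by (cases "bs = []") auto
  show thesis
  proof (rule that[OF h])
    show "h (a \<cdot>\<^bsub>W\<^esub> w) = a \<cdot>\<^bsub>L\<^esub> h w" if a: "a \<in> carrier A" and w: "w \<in> carrier W" for a w
      by (rule linear_maps_eq_on_words[OF L_module linear_maps_compose[OF lact_MX(1)[OF a] h]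
            linear_maps_compose[OF h L.lact_linear(1)[OF a]] _ w])
        (use a in \<open>auto simp: lact_MX hw f L.lact_assoc cl linear_maps_closed[OF P]\<close>)
    show "h (PX K A X w) = P (h w)" if w: "w \<in> carrier W" for w
      by (rule linear_maps_eq_on_words[OF L_module linear_maps_compose[OF PX_word(1) h]
            linear_maps_compose[OF h P] _ w])
        (auto simp: PX_word hw f L.lact_one L.lact_closed cl linear_maps_closed[OF P])
    show "h (jX K A X x) = f x" if "x \<in> X" for x
      using that f by (simp add: jX_def hw L.lact_one)
  qed
qed

text \<open>By induction on the length, the value on a word is forced by the value on \<open>j\<^sub>X(x)\<close>, and
  the words span.\<close>

lemma (in MX_setting) MX_operated_unique:
  assumes L: "left_alg_module K A L"
    and h: "h \<in> linear_maps K W L" "h' \<in> linear_maps K W L"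
    and act: "\<And>a w. \<lbrakk>a \<in> carrier A; w \<in> carrier W\<rbrakk> \<Longrightarrow> h (a \<cdot>\<^bsub>W\<^esub> w) = a \<cdot>\<^bsub>L\<^esub> h w"
      "\<And>a w. \<lbrakk>a \<in> carrier A; w \<in> carrier W\<rbrakk> \<Longrightarrow> h' (a \<cdot>\<^bsub>W\<^esub> w) = a \<cdot>\<^bsub>L\<^esub> h' w"
    and op: "\<And>w. w \<in> carrier W \<Longrightarrow> h (PX K A X w) = P (h w)"
      "\<And>w. w \<in> carrier W \<Longrightarrow> h' (PX K A X w) = P (h' w)"
    and j: "\<And>x. x \<in> X \<Longrightarrow> h (jX K A X x) = h' (jX K A X x)"
    and w: "w \<in> carrier W"
  shows "h w = h' w"
proof (rule linear_maps_eq_on_words[OF _ h _ w])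
  show "module K L" using L by (auto simp: left_alg_module_def)
  show "h (word (b # bs) x) = h' (word (b # bs) x)"
    if "b \<in> carrier A" "set bs \<subseteq> carrier A" "x \<in> X" for b bs x
    using that
  proof (induction bs arbitrary: b)
    case Nil
    then show ?case by (simp add: word_singleton act jX_closed j)
  next
    case (Cons c cs)
    then have "h (word (c # cs) x) = h' (word (c # cs) x)" by simp
    with Cons.prems show ?case
      by (simp add: word_Cons[of b "c # cs"] act op word_closed linear_maps_closed[OF PX_word(1)])
  qed
qed

section \<open>Operated quotients\<close>

lemma operated_span_generator: "S \<subseteq> operated_span K A M P S"
  by (auto simp: operated_span_def)

lemma operated_span_minimal:
  "\<lbrakk>operated_submodule K A M P H; S \<subseteq> H\<rbrakk> \<Longrightarrow> operated_span K A M P S \<subseteq> H"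
  by (auto simp: operated_span_def)

lemma (in left_alg_module) operated_span_operated_submodule:
  assumes P: "P \<in> linear_maps K M M" and S: "S \<subseteq> carrier M"
  shows "operated_submodule K A M P (operated_span K A M P S)"
proof -
  have "operated_submodule K A M P (carrier M)"
    using M.carrier_is_submodule lact_closed linear_maps_closed[OF P]
    by (simp add: operated_submodule_def)
  then have "operated_span K A M P S \<subseteq> carrier M"
    using S by (rule operated_span_minimal)
  then have "submodule (operated_span K A M P S) K M"
    by (intro submodule_criterion[OF M.module_axioms])
      (auto simp: operated_span_def operated_submodule_def
        intro: submodule_zero submodule_add submodule_smult)
  then show ?thesis by (auto simp: operated_submodule_def operated_span_def)
qed

lemma kernel_operated_submodule:
  assumes M: "left_alg_module K A M" and L: "left_alg_module K A L"
    and PL: "P\<^sub>L \<in> linear_maps K L L"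
    and h: "h \<in> linear_maps K M L"
    and act: "\<And>a m. \<lbrakk>a \<in> carrier A; m \<in> carrier M\<rbrakk> \<Longrightarrow> h (a \<cdot>\<^bsub>M\<^esub> m) = a \<cdot>\<^bsub>L\<^esub> h m"
    and P: "P \<in> linear_maps K M M"
    and op: "\<And>m. m \<in> carrier M \<Longrightarrow> h (P m) = P\<^sub>L (h m)"
  shows "operated_submodule K A M P {m \<in> carrier M. h m = \<zero>\<^bsub>L\<^esub>}"
proof -
  interpret M: left_alg_module K A M by fact
  interpret L: left_alg_module K A L by fact
  note mods = M.M.module_axioms L.M.module_axioms
  have "submodule {m \<in> carrier M. h m = \<zero>\<^bsub>L\<^esub>} K M"
    by (rule kernel_submodule[OF mods h])
  moreover have "P\<^sub>L \<zero>\<^bsub>L\<^esub> = \<zero>\<^bsub>L\<^esub>" by (rule linear_maps_zero[OF mods(2,2) PL])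
  moreover have "a \<cdot>\<^bsub>L\<^esub> \<zero>\<^bsub>L\<^esub> = \<zero>\<^bsub>L\<^esub>" if "a \<in> carrier A" for a
    by (rule linear_maps_zero[OF mods(2,2) L.lact_linear(1)[OF that]])
  ultimately show ?thesis
    by (auto simp: operated_submodule_def M.lact_closed linear_maps_closed[OF P] act op)
qed

locale operated_quotient = left_alg_module K A M
  for K :: "'k ring" and A :: "('k, 'a) module" and M :: "('k, 'a, 'm) left_module" +
  fixes P :: "'m \<Rightarrow> 'm" and H :: "'m set"
  assumes P_linear: "P \<in> linear_maps K M M" and operated: "operated_submodule K A M P H"
begin

abbreviation QM where "QM \<equiv> quot_left_module M H"
abbreviation PQ where "PQ \<equiv> quot_operator M H P"
abbreviation proj where "proj m \<equiv> H +>\<^bsub>M\<^esub> m"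

sublocale Q: module_quotient K M H
  using operated
  by (intro module_quotient.intro module_quotient_axioms.intro M.module_axioms)
    (simp add: operated_submodule_def)

lemma QM_fields:
  "carrier QM = carrier (quot_module M H)" "zero QM = zero (quot_module M H)"
  "add QM = add (quot_module M H)" "smult QM = smult (quot_module M H)"
  by (simp_all add: quot_left_module_def Let_def)

lemma QM_carrier: "carrier QM = proj ` carrier M"
  by (simp add: QM_fields Q.quot_carrier)

lemma QM_module: "module K QM"
  by (rule module_cong[OF Q.quot_is_module QM_fields])

lemma linear_maps_QM:
  "linear_maps K QM L = linear_maps K (quot_module M H) L"
  "linear_maps K L QM = linear_maps K L (quot_module M H)"
  by (simp_all add: linear_maps_def QM_fields)

lemma proj_linear: "proj \<in> linear_maps K M QM"
  using Q.quot_proj_linear by (simp add: linear_maps_QM)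

text \<open>The action of \<open>A\<close> and the operator on the quotient are both defined by unions of the form on
  the left-hand side.\<close>

lemma coset_union_linear:
  assumes f: "f \<in> linear_maps K M M" and stable: "\<And>m. m \<in> H \<Longrightarrow> f m \<in> H" and m: "m \<in> carrier M"
  shows "(\<Union>y\<in>proj m. proj (f y)) = proj (f m)"
proof (rule Q.coset_union[OF _ _ m])
  show "f y \<in> carrier M" if "y \<in> carrier M" for y using linear_maps_closed[OF f that] .
  show "f y \<ominus>\<^bsub>M\<^esub> f m \<in> H" if "y \<in> carrier M" "y \<ominus>\<^bsub>M\<^esub> m \<in> H" for y
    using stable[OF that(2)] linear_maps_minus[OF M.module_axioms M.module_axioms f that(1) m]
    by simp
qed

lemma QM_lact: "\<lbrakk>a \<in> carrier A; m \<in> carrier M\<rbrakk> \<Longrightarrow> a \<cdot>\<^bsub>QM\<^esub> proj m = proj (a \<cdot>\<^bsub>M\<^esub> m)"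
  using coset_union_linear[OF lact_linear(1)] operated
  by (simp add: quot_left_module_def Let_def operated_submodule_def)

lemma PQ_proj: "m \<in> carrier M \<Longrightarrow> PQ (proj m) = proj (P m)"
  using coset_union_linear[OF P_linear] operated
  by (simp add: quot_operator_def operated_submodule_def)

lemma QM_ops:
  "\<lbrakk>x \<in> carrier M; y \<in> carrier M\<rbrakk> \<Longrightarrow> proj x \<oplus>\<^bsub>QM\<^esub> proj y = proj (x \<oplus>\<^bsub>M\<^esub> y)"
  "\<lbrakk>x \<in> carrier M; y \<in> carrier M\<rbrakk> \<Longrightarrow> proj x \<ominus>\<^bsub>QM\<^esub> proj y = proj (x \<ominus>\<^bsub>M\<^esub> y)"
  "\<lbrakk>c \<in> carrier K; x \<in> carrier M\<rbrakk> \<Longrightarrow> c \<odot>\<^bsub>QM\<^esub> proj x = proj (c \<odot>\<^bsub>M\<^esub> x)"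
  by (simp_all add: linear_maps_add[OF proj_linear] linear_maps_smult[OF proj_linear]
      linear_maps_minus[OF M.module_axioms QM_module proj_linear])

lemma QM_left_alg_module: "left_alg_module K A QM"
proof (intro left_alg_module.intro left_alg_module_axioms.intro QM_module)
  show "assoc_algebra K A" by (rule assoc_algebra_axioms)
qed (auto simp: QM_carrier QM_lact QM_ops lact_closed lact_l_distr lact_r_distr
    lact_smult_left lact_smult_right lact_assoc lact_one)

lemma PQ_linear: "PQ \<in> linear_maps K QM QM"
  by (rule linear_mapsI)
    (auto simp: QM_carrier PQ_proj QM_ops linear_maps_closed[OF P_linear]
      linear_maps_add[OF P_linear] linear_maps_smult[OF P_linear])

text \<open>The two sides of the Nijenhuis identity for the coset of \<open>m\<close> are the cosets of the two
  sides for \<open>m\<close>, and \<open>rel\<close> says that these differ by an element of \<open>H\<close>.\<close>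

lemma QM_left_nijenhuis_module:
  assumes N: "nijenhuis_algebra K A N"
    and rel: "\<And>a m. \<lbrakk>a \<in> carrier A; m \<in> carrier M\<rbrakk> \<Longrightarrow>
      N a \<cdot>\<^bsub>M\<^esub> P m \<ominus>\<^bsub>M\<^esub> P (N a \<cdot>\<^bsub>M\<^esub> m \<oplus>\<^bsub>M\<^esub> a \<cdot>\<^bsub>M\<^esub> P m \<ominus>\<^bsub>M\<^esub> P (a \<cdot>\<^bsub>M\<^esub> m)) \<in> H"
  shows "left_nijenhuis_module K A N QM PQ"
proof (intro left_nijenhuis_module.intro left_nijenhuis_module_axioms.intro N QM_left_alg_module
    PQ_linear)
  fix a C assume a: "a \<in> carrier A" and "C \<in> carrier QM"
  then obtain m where m: "m \<in> carrier M" "C = proj m" by (auto simp: QM_carrier)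
  have Na: "N a \<in> carrier A"
    using linear_maps_closed[OF nijenhuis_algebra.N_linear[OF N] a] .
  note closed = a Na m lact_closed linear_maps_closed[OF P_linear]
  have "proj (N a \<cdot>\<^bsub>M\<^esub> P m) =
      proj (P (N a \<cdot>\<^bsub>M\<^esub> m \<oplus>\<^bsub>M\<^esub> a \<cdot>\<^bsub>M\<^esub> P m \<ominus>\<^bsub>M\<^esub> P (a \<cdot>\<^bsub>M\<^esub> m)))"
    using rel[OF a m(1)] by (subst Q.coset_eq_iff) (simp_all add: closed)
  then show "N a \<cdot>\<^bsub>QM\<^esub> PQ C =
      PQ (N a \<cdot>\<^bsub>QM\<^esub> C \<oplus>\<^bsub>QM\<^esub> a \<cdot>\<^bsub>QM\<^esub> PQ C \<ominus>\<^bsub>QM\<^esub> PQ (a \<cdot>\<^bsub>QM\<^esub> C))"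
    by (simp add: closed PQ_proj QM_lact QM_ops)
qed

lemma QM_lift:
  assumes L: "left_alg_module K A L"
    and h: "h \<in> linear_maps K M L"
    and act: "\<And>a m. \<lbrakk>a \<in> carrier A; m \<in> carrier M\<rbrakk> \<Longrightarrow> h (a \<cdot>\<^bsub>M\<^esub> m) = a \<cdot>\<^bsub>L\<^esub> h m"
    and op: "\<And>m. m \<in> carrier M \<Longrightarrow> h (P m) = P\<^sub>L (h m)"
    and kernel: "\<And>m. m \<in> H \<Longrightarrow> h m = \<zero>\<^bsub>L\<^esub>"
  obtains g where "g \<in> extensional (carrier QM)" "g \<in> left_nijenhuis_module_homs K A QM PQ L P\<^sub>L"
    and "\<And>m. m \<in> carrier M \<Longrightarrow> g (proj m) = h m"
proof -
  have L_module: "module K L" using L by (auto simp: left_alg_module_def)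
  obtain g where g: "g \<in> linear_maps K QM L" and gh: "\<And>m. m \<in> carrier M \<Longrightarrow> g (proj m) = h m"
    unfolding linear_maps_QM using Q.quot_lift[OF L_module h kernel] by blast
  let ?g = "restrict g (carrier QM)"
  have gh': "?g (proj m) = h m" if "m \<in> carrier M" for m
    using that gh by (auto simp: QM_carrier)
  have "?g \<in> linear_maps K QM L"
    by (rule linear_maps_cong[OF QM_module g]) simp
  moreover have "?g (a \<cdot>\<^bsub>QM\<^esub> C) = a \<cdot>\<^bsub>L\<^esub> ?g C" if a: "a \<in> carrier A" and "C \<in> carrier QM" for a C
  proof -
    obtain m where "m \<in> carrier M" "C = proj m" using \<open>C \<in> carrier QM\<close> by (auto simp: QM_carrier)
    then show ?thesis by (simp only: QM_lact a gh' lact_closed act)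
  qed
  moreover have "?g (PQ C) = P\<^sub>L (?g C)" if "C \<in> carrier QM" for C
  proof -
    obtain m where "m \<in> carrier M" "C = proj m" using \<open>C \<in> carrier QM\<close> by (auto simp: QM_carrier)
    then show ?thesis by (simp only: PQ_proj gh' linear_maps_closed[OF P_linear] op)
  qed
  ultimately have "?g \<in> left_nijenhuis_module_homs K A QM PQ L P\<^sub>L"
    by (simp add: left_nijenhuis_module_homs_def)
  then show thesis using gh' by (intro that[of ?g]) auto
qed

end


section \<open>The free left Nijenhuis module\<close>

theorem theorem2p18:
  fixes K :: "'k ring" and A :: "('k, 'a) module" and N :: "'a \<Rightarrow> 'a" and X :: "'x set"
  assumes "nijenhuis_algebra K A N"
  shows "free_left_nijenhuis_module TYPE('m) K A N X
           (quot_left_module (MX K A X) (IX K A N X))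
           (quot_operator (MX K A X) (IX K A N X) (PX K A X))
           (\<lambda>x. IX K A N X +>\<^bsub>MX K A X\<^esub> jX K A X x)"
proof -
  interpret N: nijenhuis_algebra K A N by fact
  interpret W: MX_setting K A X by (intro MX_setting.intro N.assoc_algebra_axioms)
  let ?W = "MX K A X" and ?P = "PX K A X"
  let ?rel = "\<lambda>a m. N a \<cdot>\<^bsub>?W\<^esub> ?P m \<ominus>\<^bsub>?W\<^esub>
    ?P (N a \<cdot>\<^bsub>?W\<^esub> m \<oplus>\<^bsub>?W\<^esub> a \<cdot>\<^bsub>?W\<^esub> ?P m \<ominus>\<^bsub>?W\<^esub> ?P (a \<cdot>\<^bsub>?W\<^esub> m))"
  let ?S = "{?rel a m | a m. a \<in> carrier A \<and> m \<in> carrier ?W}"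
  note W_alg = W.MX_left_alg_module and P = W.PX_word(1)
  interpret WM: left_alg_module K A ?W by (rule W_alg)
  have N_closed: "N a \<in> carrier A" if "a \<in> carrier A" for a
    by (rule linear_maps_closed[OF N.N_linear that])
  note closed = N_closed WM.lact_closed linear_maps_closed[OF P]
  have I: "IX K A N X = operated_span K A ?W ?P ?S"
    by (simp add: IX_def Let_def)
  have S: "?S \<subseteq> carrier ?W" by (auto simp: closed)
  interpret Q: operated_quotient K A ?W ?P "IX K A N X"
    unfolding I
    by (intro operated_quotient.intro operated_quotient_axioms.intro W_alg P
        WM.operated_span_operated_submodule S)
  have Q_module: "left_nijenhuis_module K A N Q.QM Q.PQ"
  proof (rule Q.QM_left_nijenhuis_module[OF assms])
    show "?rel a m \<in> IX K A N X" if "a \<in> carrier A" "m \<in> carrier ?W" for a m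
      unfolding I using that by (intro subsetD[OF operated_span_generator]) blast
  qed
  have universal: "\<exists>!g. g \<in> extensional (carrier Q.QM) \<and>
      g \<in> left_nijenhuis_module_homs K A Q.QM Q.PQ L N\<^sub>L \<and>
      (\<forall>x\<in>X. g (Q.proj (jX K A X x)) = f x)"
    if L: "left_nijenhuis_module K A N L N\<^sub>L" and f: "f \<in> X \<rightarrow> carrier L"
    for L :: "('k, 'a, 'm) left_module" and N\<^sub>L f
  proof (rule ex_ex1I)
    interpret L: left_nijenhuis_module K A N L N\<^sub>L by fact
    note L_alg = L.left_alg_module_axioms and NL = L.N\<^sub>M_linear
    obtain h where h: "h \<in> linear_maps K ?W L"
      and act: "\<And>a w. \<lbrakk>a \<in> carrier A; w \<in> carrier ?W\<rbrakk> \<Longrightarrow> h (a \<cdot>\<^bsub>?W\<^esub> w) = a \<cdot>\<^bsub>L\<^esub> h w"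
      and op: "\<And>w. w \<in> carrier ?W \<Longrightarrow> h (?P w) = N\<^sub>L (h w)"
      and hj: "\<And>x. x \<in> X \<Longrightarrow> h (jX K A X x) = f x"
      using W.MX_operated_lift[OF L_alg NL, of f] f by blast
    have hc: "h w \<in> carrier L" if "w \<in> carrier ?W" for w using linear_maps_closed[OF h that] .
    \<comment> \<open>\<open>h\<close> carries the defect of the Nijenhuis identity in \<open>W\<close> to the defect in \<open>L\<close>, which is
      zero.\<close>
    have "h (?rel a m) = \<zero>\<^bsub>L\<^esub>" if a: "a \<in> carrier A" and m: "m \<in> carrier ?W" for a m
    proof -
      have "h (?rel a m) = N a \<cdot>\<^bsub>L\<^esub> N\<^sub>L (h m) \<ominus>\<^bsub>L\<^esub>
          N\<^sub>L (N a \<cdot>\<^bsub>L\<^esub> h m \<oplus>\<^bsub>L\<^esub> a \<cdot>\<^bsub>L\<^esub> N\<^sub>L (h m) \<ominus>\<^bsub>L\<^esub> N\<^sub>L (a \<cdot>\<^bsub>L\<^esub> h m))"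
        using a m
        by (simp add: closed act op linear_maps_add[OF h]
            linear_maps_minus[OF WM.M.module_axioms L.M.module_axioms h])
      then show ?thesis
        using L.nijenhuis_module[OF a hc[OF m]] a m
        by (simp add: L.M.diff_eq_zero_iff N_closed L.lact_closed hc linear_maps_closed[OF NL])
    qed
    then have S0: "?S \<subseteq> {w \<in> carrier ?W. h w = \<zero>\<^bsub>L\<^esub>}"
      by (auto simp: closed)
    have "operated_submodule K A ?W ?P {w \<in> carrier ?W. h w = \<zero>\<^bsub>L\<^esub>}"
      by (rule kernel_operated_submodule[OF W_alg L_alg NL h _ P]) (simp_all add: act op)
    then have "IX K A N X \<subseteq> {w \<in> carrier ?W. h w = \<zero>\<^bsub>L\<^esub>}"
      unfolding I using S0 by (rule operated_span_minimal)
    then have kernel: "\<And>w. w \<in> IX K A N X \<Longrightarrow> h w = \<zero>\<^bsub>L\<^esub>" by blast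
    obtain g where "g \<in> extensional (carrier Q.QM)"
      "g \<in> left_nijenhuis_module_homs K A Q.QM Q.PQ L N\<^sub>L"
      and "\<And>w. w \<in> carrier ?W \<Longrightarrow> g (Q.proj w) = h w"
      using Q.QM_lift[OF L_alg h act op kernel] by blast
    then show "\<exists>g. g \<in> extensional (carrier Q.QM) \<and>
        g \<in> left_nijenhuis_module_homs K A Q.QM Q.PQ L N\<^sub>L \<and>
        (\<forall>x\<in>X. g (Q.proj (jX K A X x)) = f x)"
      using hj W.jX_closed by auto
    fix g g'
    assume g: "g \<in> extensional (carrier Q.QM) \<and>
        g \<in> left_nijenhuis_module_homs K A Q.QM Q.PQ L N\<^sub>L \<and>
        (\<forall>x\<in>X. g (Q.proj (jX K A X x)) = f x)"
      and g': "g' \<in> extensional (carrier Q.QM) \<and>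
        g' \<in> left_nijenhuis_module_homs K A Q.QM Q.PQ L N\<^sub>L \<and>
        (\<forall>x\<in>X. g' (Q.proj (jX K A X x)) = f x)"
    have lin: "g \<in> linear_maps K Q.QM L" "g' \<in> linear_maps K Q.QM L"
      using g g' by (auto simp: left_nijenhuis_module_homs_def)
    have acts: "g (a \<cdot>\<^bsub>Q.QM\<^esub> C) = a \<cdot>\<^bsub>L\<^esub> g C" "g' (a \<cdot>\<^bsub>Q.QM\<^esub> C) = a \<cdot>\<^bsub>L\<^esub> g' C"
      if "a \<in> carrier A" "C \<in> carrier Q.QM" for a C
      using g g' that by (auto simp: left_nijenhuis_module_homs_def)
    have ops: "g (Q.PQ C) = N\<^sub>L (g C)" "g' (Q.PQ C) = N\<^sub>L (g' C)" if "C \<in> carrier Q.QM" for C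
      using g g' that by (auto simp: left_nijenhuis_module_homs_def)
    have proj: "Q.proj w \<in> carrier Q.QM" if "w \<in> carrier ?W" for w
      using that by (simp add: Q.QM_carrier)
    have eq: "g (Q.proj w) = g' (Q.proj w)" if w: "w \<in> carrier ?W" for w
    proof (rule W.MX_operated_unique[OF L_alg linear_maps_compose[OF Q.proj_linear lin(1)]
          linear_maps_compose[OF Q.proj_linear lin(2)] _ _ _ _ _ w])
      fix a v assume a: "a \<in> carrier A" and v: "v \<in> carrier ?W"
      show "g (Q.proj (a \<cdot>\<^bsub>?W\<^esub> v)) = a \<cdot>\<^bsub>L\<^esub> g (Q.proj v)"
        "g' (Q.proj (a \<cdot>\<^bsub>?W\<^esub> v)) = a \<cdot>\<^bsub>L\<^esub> g' (Q.proj v)"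
        using acts[OF a proj[OF v]] by (simp_all add: Q.QM_lact[OF a v])
    next
      fix v assume v: "v \<in> carrier ?W"
      show "g (Q.proj (?P v)) = N\<^sub>L (g (Q.proj v))" "g' (Q.proj (?P v)) = N\<^sub>L (g' (Q.proj v))"
        using ops[OF proj[OF v]] by (simp_all add: Q.PQ_proj[OF v])
    qed (use g g' in auto)
    show "g = g'"
    proof
      fix C
      show "g C = g' C"
      proof (cases "C \<in> carrier Q.QM")
        case True
        then show ?thesis using eq by (auto simp: Q.QM_carrier)
      next
        case False
        then show ?thesis using g g' by (simp add: extensional_def)
      qed
    qed
  qed
  show ?thesis
    unfolding free_left_nijenhuis_module_def
  proof (intro conjI allI impI)
    show "left_nijenhuis_module K A N Q.QM Q.PQ" by (rule Q_module)
    show "(\<lambda>x. Q.proj (jX K A X x)) \<in> X \<rightarrow> carrier Q.QM"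
      using W.jX_closed by (simp add: Q.QM_carrier)
  qed (rule universal; simp)
qed

end
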